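(* Fix a positive integer $r$ and $0<\delta<1$. There is a constant $C_r>0$ depending only on $r$ such that the following holds, with $C$ the absolute constant of the oracle inequality recalled in the context. Let $\sigma>0$, $\theta^*\in\mathbb{R}^n$ and $y=\theta^*+\sigma Z$ with $Z\sim N(0,I_n)$. If $\lambda\ge C\sigma^2\log n$, then $$\mathbb{E}\|\hat\theta^{(r)}_{\mathrm{rdp},\lambda}-\theta^*\|^2\le\inf_{\theta\in\mathbb{R}^n}\Big[\frac{1+\delta}{1-\delta}\|\theta-\theta^*\|^2+\frac{\lambda C_r}{1-\delta}\,k^{(r)}_{\mathrm{all}}(\theta)\log\Big(\frac{en}{k^{(r)}_{\mathrm{all}}(\theta)}\Big)\Big]+C\,\frac{\sigma^2}{\delta(1-\delta)}.$$ As a corollary, $$\mathrm{MSE}(\hat\theta^{(r)}_{\mathrm{rdp},\lambda},\theta^* )\le C_r\,\sigma^2\,\frac{k^{(r)}_{\mathrm{all}}(\theta^* )\,\log n\,\log\big(en/k^{(r)}_{\mathrm{all}}(\theta^* )\big)}{n}.$$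
   Context: $\|\cdot\|$ is the Euclidean norm and $\mathrm{MSE}(\hat\theta,\theta^* )=\frac1n\mathbb{E}\|\hat\theta-\theta^*\|^2$ for $\theta^*\in\mathbb{R}^n$. Estimators. For $d\ge1$ let $L_{d,n}=\{1,\dots,n\}^d$, $N=n^d$. A rectangle is a nonempty product of integer intervals $\prod_{i=1}^d[a_i,b_i]\subset L_{d,n}$. $\mathcal{P}_{\mathrm{all},d,n}$ is the set of all partitions of $L_{d,n}$ into rectangles. A hierarchical split of a rectangle chooses a coordinate $j$ and replaces $[a_j,b_j]$ by $[a_j,\ell]$ and $[\ell+1,b_j]$ for some $a_j\le\ell<b_j$; a dyadic split is the special case $\ell=a_j-1+\lceil(b_j-a_j+1)/2\rceil$, $a_j<b_j$. $\mathcal{P}_{\mathrm{hier},d,n}$ (resp. $\mathcal{P}_{\mathrm{rdp},d,n}$) is the set of partitions obtainable from $\{L_{d,n}\}$ by finitely many successive hierarchical (resp. dyadic) splits of constituent rectangles. $|\Pi|$ is the number of rectangles of $\Pi$. For an integer $q\ge 0$, $S^{(q)}(\Pi)$ is the subspace of arrays that on each rectangle of $\Pi$ agree with $(i_1,\dots,i_d)\mapsto f(i_1/n,\dots,i_d/n)$ for some polynomial $f$ of total degree at most $q$, and $O_S$ is orthogonal projection onto $S$. For $a\in\{\mathrm{rdp},\mathrm{hier},\mathrm{all}\}$, $\hat\theta^{(q)}_{a,\lambda}=O_{S^{(q)}(\hat\Pi)}y$ where $\hat\Pi$ minimizes $\|y-O_{S^{(q)}(\Pi)}y\|^2+\lambda|\Pi|$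 over $\Pi\in\mathcal{P}_{a,d,n}$, and $k^{(q)}_a(\theta)=\min\{|\Pi|:\Pi\in\mathcal{P}_{a,d,n},\ \theta\in S^{(q)}(\Pi)\}$. In the claim $d=1$, rectangles are intervals, and $\hat\theta^{(r)}_{\mathrm{rdp},\lambda}$ is the univariate Dyadic CART estimator of order $r$. The constant $C$. $C>0$ is an absolute constant for which the following oracle inequality holds: for every integer $q\ge0$, every $0<\delta<1$ and every $\lambda\ge C K_{q,d}\,\sigma^2\log N/\delta$, where $K_{q,d}=\binom{q+d-1}{d-1}$, if $y=\theta^*+\sigma Z$ with $Z$ having independent standard Gaussian entries, then for $a\in\{\mathrm{rdp},\mathrm{hier},\mathrm{all}\}$, $\mathbb{E}\|\hat\theta^{(q)}_{a,\lambda}-\theta^*\|^2\le\inf_{\theta\in\mathbb{R}^N}\big[\frac{1+\delta}{1-\delta}\|\theta-\theta^*\|^2+\frac{\lambda}{1-\delta}k^{(q)}_a(\theta)\big]+C\frac{\sigma^2}{\delta(1-\delta)}$.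
   Formalization: The corollary is stated for λ = Cσ² log n and n ≥ 2 (it fails at n = 1 and as λ → ∞), and the oracle inequality is assumed only for q = r, since no single C can serve all q; C_r may depend on this C. *)

theory Defs
  imports "HOL-Probability.Probability" "HOL-Library.Disjoint_Sets"
begin

definition grid :: "nat \<Rightarrow> nat \<Rightarrow> nat list set" where
  "grid d n = {x. length x = d \<and> set x \<subseteq> {1..n}}"

text \<open>Arrays indexed by the lattice are extensional functions, so that equality of arrays
  is equality on the lattice.\<close>

definition arrays :: "nat \<Rightarrow> nat \<Rightarrow> (nat list \<Rightarrow> real) set" where
  "arrays d n = grid d n \<rightarrow>\<^sub>E UNIV"

definition grid_box :: "nat list \<Rightarrow> nat list \<Rightarrow> nat list set" where
  "grid_box a b = {x. list_all2 (\<le>) a x \<and> list_all2 (\<le>) x b}"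

definition is_rectangle :: "nat \<Rightarrow> nat \<Rightarrow> nat list set \<Rightarrow> bool" where
  "is_rectangle d n R \<longleftrightarrow> (\<exists>a b. R = grid_box a b) \<and> R \<noteq> {} \<and> R \<subseteq> grid d n"

definition hier_split :: "nat list set \<Rightarrow> nat list set \<Rightarrow> nat list set \<Rightarrow> bool" where
  "hier_split R R1 R2 \<longleftrightarrow> (\<exists>a b j l. R = grid_box a b \<and> R \<noteq> {} \<and> j < length a \<and>
      a ! j \<le> l \<and> l < b ! j \<and>
      R1 = grid_box a (b[j := l]) \<and> R2 = grid_box (a[j := l + 1]) b)"

definition dyadic_split :: "nat list set \<Rightarrow> nat list set \<Rightarrow> nat list set \<Rightarrow> bool" where
  "dyadic_split R R1 R2 \<longleftrightarrow> (\<exists>a b j l. R = grid_box a b \<and> R \<noteq> {} \<and> j < length a \<and>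
      a ! j < b ! j \<and>
      int l = int (a ! j) - 1 + \<lceil>(real (b ! j) - real (a ! j) + 1) / 2\<rceil> \<and>
      R1 = grid_box a (b[j := l]) \<and> R2 = grid_box (a[j := l + 1]) b)"

inductive_set split_partitions ::
    "(nat list set \<Rightarrow> nat list set \<Rightarrow> nat list set \<Rightarrow> bool) \<Rightarrow> nat \<Rightarrow> nat \<Rightarrow> nat list set set set"
  for split :: "nat list set \<Rightarrow> nat list set \<Rightarrow> nat list set \<Rightarrow> bool" and d n :: nat where
  start: "{grid d n} \<in> split_partitions split d n"
| step: "\<lbrakk>P \<in> split_partitions split d n; R \<in> P; split R R1 R2\<rbrakk>
    \<Longrightarrow> (P - {R}) \<union> {R1, R2} \<in> split_partitions split d n"

datatype family = RDP | Hier | All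

fun partitions :: "family \<Rightarrow> nat \<Rightarrow> nat \<Rightarrow> nat list set set set" where
  "partitions RDP d n = split_partitions dyadic_split d n"
| "partitions Hier d n = split_partitions hier_split d n"
| "partitions All d n = {P. partition_on (grid d n) P \<and> (\<forall>R\<in>P. is_rectangle d n R)}"

text \<open>A polynomial in d variables of total degree at most q is given by its coefficients c,
  indexed by the exponent vectors.\<close>

definition poly_eval :: "nat \<Rightarrow> nat \<Rightarrow> (nat list \<Rightarrow> real) \<Rightarrow> real list \<Rightarrow> real" where
  "poly_eval d q c x =
     (\<Sum>\<alpha> | length \<alpha> = d \<and> sum_list \<alpha> \<le> q. c \<alpha> * (\<Prod>j<d. (x ! j) ^ (\<alpha> ! j)))"

definition pp_space :: "nat \<Rightarrow> nat \<Rightarrow> nat \<Rightarrow> nat list set set \<Rightarrow> (nat list \<Rightarrow> real) set" where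
  "pp_space q d n P = {\<theta> \<in> arrays d n.
     \<forall>R\<in>P. \<exists>c. \<forall>i\<in>R. \<theta> i = poly_eval d q c (map (\<lambda>m. real m / real n) i)}"

definition orth_proj :: "'i set \<Rightarrow> ('i \<Rightarrow> real) set \<Rightarrow> ('i \<Rightarrow> real) \<Rightarrow> 'i \<Rightarrow> real" where
  "orth_proj I S y = (THE v. v \<in> S \<and> (\<forall>w\<in>S. (\<Sum>i\<in>I. (y i - v i) * w i) = 0))"

definition sq_dist :: "'i set \<Rightarrow> ('i \<Rightarrow> real) \<Rightarrow> ('i \<Rightarrow> real) \<Rightarrow> real" where
  "sq_dist I x y = (L2_set (\<lambda>i. x i - y i) I)\<^sup>2"

definition objective ::
    "nat \<Rightarrow> real \<Rightarrow> nat \<Rightarrow> nat \<Rightarrow> (nat list \<Rightarrow> real) \<Rightarrow> nat list set set \<Rightarrow> real" where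
  "objective q lam d n y P =
     sq_dist (grid d n) y (orth_proj (grid d n) (pp_space q d n P) y) + lam * real (card P)"

text \<open>Ties between minimizing partitions are broken by Hilbert choice. For Gaussian data
  all minimizing partitions almost surely give the same projection.\<close>

definition estimator ::
    "family \<Rightarrow> nat \<Rightarrow> real \<Rightarrow> nat \<Rightarrow> nat \<Rightarrow> (nat list \<Rightarrow> real) \<Rightarrow> nat list \<Rightarrow> real" where
  "estimator a q lam d n y = orth_proj (grid d n)
     (pp_space q d n (arg_min_on (objective q lam d n y) (partitions a d n))) y"

definition num_pieces :: "family \<Rightarrow> nat \<Rightarrow> nat \<Rightarrow> nat \<Rightarrow> (nat list \<Rightarrow> real) \<Rightarrow> nat" where
  "num_pieces a q d n \<theta> = Min (card ` {P \<in> partitions a d n. \<theta> \<in> pp_space q d n P})"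

definition std_gaussian :: "'i set \<Rightarrow> ('i \<Rightarrow> real) measure" where
  "std_gaussian I = (\<Pi>\<^sub>M i\<in>I. density lborel (\<lambda>x. ennreal (std_normal_density x)))"

definition risk ::
    "family \<Rightarrow> nat \<Rightarrow> real \<Rightarrow> nat \<Rightarrow> nat \<Rightarrow> real \<Rightarrow> (nat list \<Rightarrow> real) \<Rightarrow> real" where
  "risk a q lam d n \<sigma> \<theta>s = (LINT z|std_gaussian (grid d n).
     sq_dist (grid d n) (estimator a q lam d n (\<lambda>i\<in>grid d n. \<theta>s i + \<sigma> * z i)) \<theta>s)"

definition MSE ::
    "family \<Rightarrow> nat \<Rightarrow> real \<Rightarrow> nat \<Rightarrow> nat \<Rightarrow> real \<Rightarrow> (nat list \<Rightarrow> real) \<Rightarrow> real" where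
  "MSE a q lam d n \<sigma> \<theta>s = risk a q lam d n \<sigma> \<theta>s / real (n ^ d)"

text \<open>The oracle inequality with constant C for polynomial order q. The order is a parameter
  rather than quantified inside: the factor (q+d-1 choose d-1) equals 1 for d = 1, while
  the polynomial pieces have up to q+1 degrees of freedom, so no single C serves all q at once
  (take d = 1, mean zero, q \<ge> n - 1: the estimator is y itself, with risk n \<sigma>^2).\<close>

definition oracle_inequality :: "real \<Rightarrow> nat \<Rightarrow> bool" where
  "oracle_inequality C q \<longleftrightarrow>
    (\<forall>a d n \<delta> \<sigma> lam. \<forall>\<theta>s \<in> arrays d n.
       1 \<le> d \<and> 1 \<le> n \<and> 0 < \<delta> \<and> \<delta> < 1 \<and> 0 < \<sigma> \<and>
       C * real ((q + d - 1) choose (d - 1)) * \<sigma>\<^sup>2 * ln (real (n ^ d)) / \<delta> \<le> lam \<longrightarrow>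
       risk a q lam d n \<sigma> \<theta>s
         \<le> (INF \<theta> \<in> arrays d n. (1 + \<delta>) / (1 - \<delta>) * sq_dist (grid d n) \<theta> \<theta>s
               + lam / (1 - \<delta>) * real (num_pieces a q d n \<theta>))
           + C * (\<sigma>\<^sup>2 / (\<delta> * (1 - \<delta>))))"

end

theory Submission
  imports Defs
begin

text \<open>
  In dimension one every cell has at most one dyadic split, so the recursive dyadic partitions
  are the leaf sets of subtrees of one binary tree, and both the residual sum of squares and the
  penalty are additive over cells. Compare the selected partition with a fixed dyadic partition
  \<open>P\<close> on the cells where one of the two stops splitting first. Where the selected partition is
  finer, its gain in residual sum of squares pays for the additional pieces, hence, unless the
  noise is exceptional, most of this gain is bias and splitting did not increase the loss. Where it is
  coarser, the additional bias is at most a multiple of the penalty. Thus the loss exceeds the loss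
  of \<open>P\<close> by a multiple of \<open>lam * card P\<close> and of the noise at the \<open>2 * card P - 1\<close> nodes of the
  tree of \<open>P\<close>, with leading constant one in front of the squared bias.

  The expected supremum of the noise over all subtrees below a node is bounded by a generating
  function over trees. It is finite as soon as the penalty per piece exceeds a constant multiple
  of \<open>\<sigma>\<^sup>2\<close>; no logarithm is needed. A penalty \<open>C * \<sigma>\<^sup>2 * ln n\<close> therefore suffices for every \<open>C > 0\<close>
  and \<open>n \<ge> 2\<close>, including the range \<open>lam < C * \<sigma>\<^sup>2 * ln n / \<delta>\<close> that the assumed inequality leaves out.
  For \<open>n = 1\<close>, where \<open>lam = 0\<close> is possible, the assumed inequality applies directly.

  Finally, a partition into \<open>k\<close> intervals has a dyadic refinement with at most
  \<open>2 ^ j + (k - 1) * (L - j)\<close> pieces for \<open>n \<le> 2 ^ L\<close> and \<open>j \<le> L\<close>; with \<open>2 ^ j\<close> of order \<open>k\<close> this is of order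
  \<open>k * ln (e * n / k)\<close>.
\<close>

section \<open>Gaussian vectors\<close>

text \<open>The factor \<open>exp (x\<^sup>2 / 4)\<close> halves the negative exponent, which leaves
  an unnormalized Gaussian of variance 2. Its mass \<open>sqrt 2\<close> is the exponential moment
  of a squared standard normal, with no integral to compute.\<close>

lemma std_normal_exp_sq:
  "(\<lambda>x. std_normal_density x * exp (x\<^sup>2 / 4)) = (\<lambda>x. sqrt 2 * normal_density 0 (sqrt 2) x)"
proof
  fix x :: real
  have "exp (- x\<^sup>2 / 2) * exp (x\<^sup>2 / 4) = exp (- x\<^sup>2 / 4)"
    by (simp add: exp_add[symmetric])
  then show "std_normal_density x * exp (x\<^sup>2 / 4) = sqrt 2 * normal_density 0 (sqrt 2) x"
    by (simp add: normal_density_def real_sqrt_mult field_simps)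
qed

lemma (in prob_space) exp_sq_std_normal:
  assumes "distributed M lborel X std_normal_density"
  shows "integrable M (\<lambda>x. exp ((X x)\<^sup>2 / 4))" "expectation (\<lambda>x. exp ((X x)\<^sup>2 / 4)) = sqrt 2"
  using distributed_integrable[OF assms, of "\<lambda>x. exp (x\<^sup>2 / 4)"]
    distributed_integral[OF assms, of "\<lambda>x. exp (x\<^sup>2 / 4)"]
  by (simp_all add: std_normal_exp_sq)

lemma prob_space_std_gaussian: "prob_space (std_gaussian I)"
  unfolding std_gaussian_def by (intro prob_space_PiM prob_space_normal_density) simp

lemma space_std_gaussian: "space (std_gaussian I) = I \<rightarrow>\<^sub>E UNIV"
  by (simp add: std_gaussian_def space_PiM)

lemma std_gaussian_coordinate_measurable:
  assumes "i \<in> I" shows "(\<lambda>z. z i) \<in> borel_measurable (std_gaussian I)"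
  using measurable_component_singleton[OF assms, of "\<lambda>i. density lborel std_normal_density"]
  by (simp add: std_gaussian_def)

lemma std_gaussian_coordinate_distributed:
  assumes "i \<in> I" shows "distributed (std_gaussian I) lborel (\<lambda>z. z i) std_normal_density"
proof -
  let ?N = "density lborel (\<lambda>x. ennreal (std_normal_density x))"
  have "distr (std_gaussian I) lborel (\<lambda>z. z i) = distr (std_gaussian I) ?N (\<lambda>z. z i)"
    by (intro distr_cong) auto
  also have "\<dots> = ?N"
    unfolding std_gaussian_def using assms
    by (intro distr_PiM_component prob_space_normal_density) auto
  finally show ?thesis
    using std_gaussian_coordinate_measurable[OF assms] by (simp add: distributed_def)
qed

text \<open>Independence is read off the joint law: the joint map of the coordinates is the identity
  on extensional functions, so its law is the product of the marginals. This criterion requires a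
  nonempty index set.\<close>

lemma std_gaussian_coordinates_indep:
  assumes "finite I"
  shows "prob_space.indep_vars (std_gaussian I) (\<lambda>_. borel) (\<lambda>i z. z i) I"
proof (cases "I = {}")
  case True
  interpret prob_space "std_gaussian ({} :: 'a set)" by (rule prob_space_std_gaussian)
  show ?thesis using True by (simp add: indep_vars_def indep_sets_def)
next
  case False
  interpret prob_space "std_gaussian I" by (rule prob_space_std_gaussian)
  let ?N = "density lborel (\<lambda>x. ennreal (std_normal_density x))"
  have D: "distr (std_gaussian I) borel (\<lambda>z. z i) = ?N" if "i \<in> I" for i
  proof -
    have "distr (std_gaussian I) borel (\<lambda>z. z i) = distr (std_gaussian I) lborel (\<lambda>z. z i)"
      by (intro distr_cong) auto
    then show ?thesis
      using std_gaussian_coordinate_distributed[OF that] by (simp add: distributed_def)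
  qed
  have "distr (std_gaussian I) (Pi\<^sub>M I (\<lambda>_. borel)) (\<lambda>x. \<lambda>i\<in>I. x i)
      = distr (std_gaussian I) (std_gaussian I) (\<lambda>x. x)"
  proof (rule distr_cong)
    show "sets (Pi\<^sub>M I (\<lambda>_. borel)) = sets (std_gaussian I)"
      unfolding std_gaussian_def by (intro sets_PiM_cong) auto
    show "\<And>x. x \<in> space (std_gaussian I) \<Longrightarrow> (\<lambda>i\<in>I. x i) = x"
      by (auto simp: space_std_gaussian PiE_def extensional_restrict)
  qed simp
  also have "\<dots> = (\<Pi>\<^sub>M i\<in>I. distr (std_gaussian I) borel (\<lambda>z. z i))"
    unfolding distr_id by (subst (1) std_gaussian_def) (intro PiM_cong, auto simp: D)
  finally show ?thesis
    using False by (subst indep_vars_iff_distr_eq_PiM')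
      (auto intro: std_gaussian_coordinate_measurable)
qed

lemma std_gaussian_unit_functional_distributed:
  assumes I: "finite I" and J: "J \<subseteq> I" and e: "(\<Sum>i\<in>J. (e i)\<^sup>2) = 1"
  shows "distributed (std_gaussian I) lborel (\<lambda>z. \<Sum>i\<in>J. z i * e i) std_normal_density"
proof -
  interpret prob_space "std_gaussian I" by (rule prob_space_std_gaussian)
  \<comment> \<open>Coordinates with zero coefficient are dropped, since the sum rule for
    independent normals asks for positive standard deviations.\<close>
  let ?K = "{i\<in>J. e i \<noteq> 0}"
  have fin: "finite J" using I J finite_subset by blast
  have K: "finite ?K" "?K \<subseteq> I" using fin J by auto
  have e1: "(\<Sum>i\<in>?K. (e i)\<^sup>2) = 1"
    using e by (subst sum.mono_neutral_left[OF fin]) auto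
  then have ne: "?K \<noteq> {}" by (metis sum.empty zero_neq_one)
  have "distributed (std_gaussian I) lborel (\<lambda>z. \<Sum>i\<in>?K. e i * z i)
      (normal_density (\<Sum>i\<in>?K. 0) (sqrt (\<Sum>i\<in>?K. \<bar>e i\<bar>\<^sup>2)))"
  proof (rule sum_indep_normal[OF K(1) ne])
    show "indep_vars (\<lambda>_. borel) (\<lambda>i z. e i * z i) ?K"
      by (rule indep_vars_compose2[OF indep_vars_subset[OF std_gaussian_coordinates_indep[OF I] K(2)]])
        simp
    show "0 < \<bar>e i\<bar>" if "i \<in> ?K" for i using that by simp
    show "distributed (std_gaussian I) lborel (\<lambda>z. e i * z i) (normal_density 0 \<bar>e i\<bar>)"
      if "i \<in> ?K" for i
    proof -
      have "i \<in> I" using that K by auto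
      from normal_density_affine[OF std_gaussian_coordinate_distributed[OF this], of "e i" 0] that
      show ?thesis by simp
    qed
  qed
  moreover have "(\<Sum>i\<in>?K. e i * z i) = (\<Sum>i\<in>J. z i * e i)" for z
    by (subst sum.mono_neutral_left[OF fin, of ?K]) (auto simp: mult.commute intro: sum.cong)
  ultimately show ?thesis using e1 by simp
qed

lemma exp_average_le:
  fixes a :: "nat \<Rightarrow> real"
  assumes "0 < m"
  shows "exp ((\<Sum>j<m. a j) / real m) \<le> (\<Sum>j<m. exp (a j)) / real m"
proof -
  have "exp (\<Sum>j<m. (1 / real m) *\<^sub>R a j) \<le> (\<Sum>j<m. (1 / real m) * exp (a j))"
    using assms by (intro convex_on_sum[where C = UNIV] exp_convex) auto
  then show ?thesis by (simp add: sum_divide_distrib)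
qed

lemma std_gaussian_exp_energy:
  assumes I: "finite I" and J: "J \<subseteq> I" and m: "0 < m"
    and e: "\<And>j. j < m \<Longrightarrow> (\<Sum>i\<in>J. (e j i)\<^sup>2) \<in> {0, 1}"
  shows "integrable (std_gaussian I) (\<lambda>z. exp ((\<Sum>j<m. (\<Sum>i\<in>J. z i * e j i)\<^sup>2) / (4 * real m)))"
    and "(LINT z|std_gaussian I. exp ((\<Sum>j<m. (\<Sum>i\<in>J. z i * e j i)\<^sup>2) / (4 * real m))) \<le> sqrt 2"
proof -
  interpret prob_space "std_gaussian I" by (rule prob_space_std_gaussian)
  let ?g = "\<lambda>j z. \<Sum>i\<in>J. z i * e j i"
  have fin: "finite J" using I J finite_subset by blast
  have meas [measurable]: "(\<lambda>z. z i) \<in> borel_measurable (std_gaussian I)" if "i \<in> J" for i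
    using that J by (intro std_gaussian_coordinate_measurable) auto
  have one: "integrable (std_gaussian I) (\<lambda>z. exp ((?g j z)\<^sup>2 / 4)) \<and>
      expectation (\<lambda>z. exp ((?g j z)\<^sup>2 / 4)) \<le> sqrt 2" if "j < m" for j
  proof (cases "(\<Sum>i\<in>J. (e j i)\<^sup>2) = 0")
    case True
    then have "\<And>i. i \<in> J \<Longrightarrow> e j i = 0"
      using fin by (simp add: sum_nonneg_eq_0_iff)
    then have "\<And>z. ?g j z = 0" by simp
    then show ?thesis by (simp add: prob_space)
  next
    case False
    then have "(\<Sum>i\<in>J. (e j i)\<^sup>2) = 1" using e[OF that] by blast
    from exp_sq_std_normal[OF std_gaussian_unit_functional_distributed[OF I J this]]
    show ?thesis by simp
  qed
  let ?h = "\<lambda>z. (\<Sum>j<m. exp ((?g j z)\<^sup>2 / 4)) / real m"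
  have bound: "exp ((\<Sum>j<m. (?g j z)\<^sup>2) / (4 * real m)) \<le> ?h z" for z
    using exp_average_le[OF m, of "\<lambda>j. (?g j z)\<^sup>2 / 4"]
    by (simp add: sum_divide_distrib[symmetric])
  have inth: "integrable (std_gaussian I) ?h"
    using one by (intro integrable_divide_zero Bochner_Integration.integrable_sum) auto
  show int: "integrable (std_gaussian I) (\<lambda>z. exp ((\<Sum>j<m. (?g j z)\<^sup>2) / (4 * real m)))"
  proof (rule Bochner_Integration.integrable_bound[OF inth])
    show "(\<lambda>z. exp ((\<Sum>j<m. (?g j z)\<^sup>2) / (4 * real m))) \<in> borel_measurable (std_gaussian I)"
      by measurable
    have "\<bar>exp ((\<Sum>j<m. (?g j z)\<^sup>2) / (4 * real m))\<bar> \<le> \<bar>?h z\<bar>" for z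
      using order_trans[OF bound[of z] abs_ge_self] by simp
    then show "AE z in std_gaussian I.
        norm (exp ((\<Sum>j<m. (?g j z)\<^sup>2) / (4 * real m))) \<le> norm (?h z)" by simp
  qed
  have "expectation (\<lambda>z. exp ((\<Sum>j<m. (?g j z)\<^sup>2) / (4 * real m))) \<le> expectation ?h"
    by (intro integral_mono int inth bound)
  also have "\<dots> = (\<Sum>j<m. expectation (\<lambda>z. exp ((?g j z)\<^sup>2 / 4))) / real m"
    using one by (simp add: Bochner_Integration.integral_sum)
  also have "\<dots> \<le> (\<Sum>j<m. sqrt 2) / real m"
    using one by (intro divide_right_mono sum_mono) auto
  finally show "expectation (\<lambda>z. exp ((\<Sum>j<m. (?g j z)\<^sup>2) / (4 * real m))) \<le> sqrt 2"
    using m by simp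
qed

text \<open>Functions of disjoint blocks of coordinates are independent. The assumption
  \<open>local\<close> says that \<open>f J\<close> sees only the coordinates in \<open>J\<close>,
  so that it factors through the restriction to the block.\<close>

lemma std_gaussian_prod_blocks:
  fixes f :: "'i set \<Rightarrow> ('i \<Rightarrow> real) \<Rightarrow> real"
  assumes I: "finite I" and Q: "finite Q" "\<And>J. J \<in> Q \<Longrightarrow> J \<subseteq> I" "disjoint Q"
    and meas: "\<And>J. J \<in> Q \<Longrightarrow> f J \<in> borel_measurable (Pi\<^sub>M J (\<lambda>_. borel))"
    and local: "\<And>J z. J \<in> Q \<Longrightarrow> f J (restrict z J) = f J z"
    and int: "\<And>J. J \<in> Q \<Longrightarrow> integrable (std_gaussian I) (f J)"
  shows "integrable (std_gaussian I) (\<lambda>z. \<Prod>J\<in>Q. f J z)"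
    and "(LINT z|std_gaussian I. (\<Prod>J\<in>Q. f J z)) = (\<Prod>J\<in>Q. (LINT z|std_gaussian I. f J z))"
proof -
  interpret prob_space "std_gaussian I" by (rule prob_space_std_gaussian)
  have "indep_vars (\<lambda>J. Pi\<^sub>M J (\<lambda>_. borel)) (\<lambda>J z. restrict (\<lambda>i. z i) J) Q"
    using indep_vars_restrict[OF std_gaussian_coordinates_indep[OF I], of Q "\<lambda>J. J"] Q
    by (auto simp: disjoint_family_on_def disjoint_def pairwise_def disjnt_def)
  from indep_vars_compose2[OF this, of f "\<lambda>_. borel"] meas
  have "indep_vars (\<lambda>_. borel) (\<lambda>J z. f J (restrict z J)) Q" by simp
  then have ind: "indep_vars (\<lambda>_. borel) f Q"
    by (subst (asm) indep_vars_cong[where Y = f and N' = "\<lambda>_. borel" and J = Q]) (auto simp: local)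
  show "integrable (std_gaussian I) (\<lambda>z. \<Prod>J\<in>Q. f J z)"
    by (rule indep_vars_integrable[OF Q(1) ind int])
  show "(LINT z|std_gaussian I. (\<Prod>J\<in>Q. f J z)) = (\<Prod>J\<in>Q. (LINT z|std_gaussian I. f J z))"
    by (rule indep_vars_lebesgue_integral[OF Q(1) ind int])
qed

section \<open>Least squares on a cell\<close>

definition ip :: "'i set \<Rightarrow> ('i \<Rightarrow> real) \<Rightarrow> ('i \<Rightarrow> real) \<Rightarrow> real" where
  "ip I f g = (\<Sum>i\<in>I. f i * g i)"

lemma ip_commute: "ip I f g = ip I g f"
  by (simp add: ip_def mult.commute)

lemma ip_cong: "(\<And>i. i \<in> I \<Longrightarrow> f i = f' i) \<Longrightarrow> (\<And>i. i \<in> I \<Longrightarrow> g i = g' i) \<Longrightarrow> ip I f g = ip I f' g'"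
  by (simp add: ip_def)

lemma ip_add: "ip I (\<lambda>i. f i + g i) h = ip I f h + ip I g h"
  and ip_diff: "ip I (\<lambda>i. f i - g i) h = ip I f h - ip I g h"
  and ip_scale: "ip I (\<lambda>i. c * f i) h = c * ip I f h"
  and ip_sum: "ip I (\<lambda>i. \<Sum>j\<in>A. F j i) h = (\<Sum>j\<in>A. ip I (F j) h)"
  by (simp_all add: ip_def algebra_simps sum.distrib sum_subtractf sum_distrib_left sum.swap[of _ A])

lemma ip_add_right: "ip I h (\<lambda>i. f i + g i) = ip I h f + ip I h g"
  and ip_diff_right: "ip I h (\<lambda>i. f i - g i) = ip I h f - ip I h g"
  and ip_scale_right: "ip I h (\<lambda>i. c * f i) = c * ip I h f"
  and ip_sum_right: "ip I h (\<lambda>i. \<Sum>j\<in>A. F j i) = (\<Sum>j\<in>A. ip I h (F j))"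
  by (simp_all add: ip_commute[of I h] ip_add ip_diff ip_scale ip_sum)

lemmas ip_linear = ip_add ip_diff ip_scale ip_sum ip_add_right ip_diff_right ip_scale_right ip_sum_right

lemma ip_self_nonneg: "0 \<le> ip I f f"
  by (simp add: ip_def sum_nonneg)

lemma ip_self_eq_0: "finite I \<Longrightarrow> ip I f f = 0 \<Longrightarrow> i \<in> I \<Longrightarrow> f i = 0"
  by (simp add: ip_def sum_nonneg_eq_0_iff)

lemma ip_partition:
  assumes "finite R" "partition_on R P"
  shows "ip R f g = (\<Sum>I\<in>P. ip I f g)"
  using assms sum.Union_disjoint_sets[of P "\<lambda>i. f i * g i"]
  by (auto simp: ip_def partition_on_def intro: finite_subset)

text \<open>Values outside \<open>I\<close> are free, so one family of globally defined functions
  serves all cells.\<close>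

definition span_on :: "'i set \<Rightarrow> (nat \<Rightarrow> 'i \<Rightarrow> real) \<Rightarrow> nat \<Rightarrow> ('i \<Rightarrow> real) set" where
  "span_on I b m = {f. \<exists>c. \<forall>i\<in>I. f i = (\<Sum>j<m. c j * b j i)}"

lemma span_onI: "(\<And>i. i \<in> I \<Longrightarrow> f i = (\<Sum>j<m. c j * b j i)) \<Longrightarrow> f \<in> span_on I b m"
  unfolding span_on_def by blast

lemma span_on_mono_set: "f \<in> span_on R b m \<Longrightarrow> I \<subseteq> R \<Longrightarrow> f \<in> span_on I b m"
  by (fastforce simp: span_on_def)

lemma span_on_Suc:
  "f \<in> span_on I b (Suc m) \<longleftrightarrow> (\<exists>c. (\<lambda>i. f i - c * b m i) \<in> span_on I b m)"
proof
  assume "f \<in> span_on I b (Suc m)"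
  then obtain c where "\<forall>i\<in>I. f i = (\<Sum>j<Suc m. c j * b j i)" by (auto simp: span_on_def)
  then have "(\<lambda>i. f i - c m * b m i) \<in> span_on I b m" by (intro span_onI[where c = c]) simp
  then show "\<exists>c. (\<lambda>i. f i - c * b m i) \<in> span_on I b m" ..
next
  assume "\<exists>c. (\<lambda>i. f i - c * b m i) \<in> span_on I b m"
  then obtain c d where d: "\<forall>i\<in>I. f i - c * b m i = (\<Sum>j<m. d j * b j i)"
    by (auto simp: span_on_def)
  have "(\<Sum>j<Suc m. (if j < m then d j else c) * b j i) = (\<Sum>j<m. d j * b j i) + c * b m i" for i
    by simp
  with d show "f \<in> span_on I b (Suc m)"
    by (intro span_onI[where c = "\<lambda>j. if j < m then d j else c"]) (simp only:, simp add: algebra_simps)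
qed

lemma span_on_lincomb:
  assumes "f \<in> span_on I b m" "g \<in> span_on I b m"
  shows "(\<lambda>i. f i + c * g i) \<in> span_on I b m"
proof -
  obtain a d where "\<forall>i\<in>I. f i = (\<Sum>j<m. a j * b j i)" "\<forall>i\<in>I. g i = (\<Sum>j<m. d j * b j i)"
    using assms by (auto simp: span_on_def)
  then show ?thesis
    by (intro span_onI[where c = "\<lambda>j. a j + c * d j"])
      (simp add: sum.distrib sum_distrib_left algebra_simps)
qed

lemma span_on_cong:
  "(\<And>i. i \<in> I \<Longrightarrow> f i = g i) \<Longrightarrow> f \<in> span_on I b m \<longleftrightarrow> g \<in> span_on I b m"
  by (simp add: span_on_def)

lemma span_on_cong_basis:
  "(\<And>j i. j < m \<Longrightarrow> i \<in> I \<Longrightarrow> b j i = b' j i) \<Longrightarrow> span_on I b m = span_on I b' m"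
  by (simp add: span_on_def)

text \<open>Gram--Schmidt without discarding dependent vectors: these become zero on the
  index set, so that the number of vectors is kept.\<close>

definition partial_onb :: "'i set \<Rightarrow> (nat \<Rightarrow> 'i \<Rightarrow> real) \<Rightarrow> nat \<Rightarrow> (nat \<Rightarrow> 'i \<Rightarrow> real) \<Rightarrow> bool" where
  "partial_onb I b m e \<longleftrightarrow> (\<forall>j<m. \<forall>l<m. j \<noteq> l \<longrightarrow> ip I (e j) (e l) = 0) \<and>
     (\<forall>j<m. ip I (e j) (e j) \<in> {0, 1}) \<and> span_on I e m = span_on I b m"

lemma ip_partial_onb_vanish:
  assumes "finite I" "partial_onb I b m e" "j < m" "ip I (e j) (e j) \<noteq> 1"
  shows "ip I f (e j) = 0"
proof -
  have "ip I (e j) (e j) = 0" using assms by (auto simp: partial_onb_def)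
  from ip_self_eq_0[OF assms(1) this] show ?thesis by (simp add: ip_def)
qed

lemma partial_onb_residual_orthogonal:
  assumes "finite I" "partial_onb I b m e" "l < m"
  shows "ip I (\<lambda>i. f i - (\<Sum>j<m. ip I f (e j) * e j i)) (e l) = 0"
proof -
  have "(\<Sum>j<m. ip I f (e j) * ip I (e j) (e l)) = (\<Sum>j<m. if j = l then ip I f (e l) * ip I (e l) (e l) else 0)"
    using assms by (intro sum.cong) (auto simp: partial_onb_def)
  \<comment> \<open>If \<open>e l\<close> vanishes on \<open>I\<close>, both sides are zero.\<close>
  also have "\<dots> = ip I f (e l)"
    using assms ip_partial_onb_vanish[OF assms, of f] by (cases "ip I (e l) (e l) = 1") auto
  finally show ?thesis by (simp add: ip_linear)
qed

lemma ex_partial_onb: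
  assumes I: "finite I" shows "\<exists>e. partial_onb I b m e"
proof (induction m)
  case 0
  then show ?case by (simp add: partial_onb_def span_on_def)
next
  case (Suc m)
  then obtain e where e: "partial_onb I b m e" ..
  define r where "r = (\<lambda>i. b m i - (\<Sum>j<m. ip I (b m) (e j) * e j i))"
  define s where "s = sqrt (ip I r r)"
  \<comment> \<open>For \<open>s = 0\<close> the quotient \<open>1 / s\<close> is zero, and the new
    vector is the vanishing one that a dependent \<open>b m\<close> should produce.\<close>
  define e' where "e' = e(m := (\<lambda>i. (1 / s) * r i))"
  have old: "e' j = e j" if "j < m" for j using that by (simp add: e'_def)
  have new: "e' m = (\<lambda>i. (1 / s) * r i)" by (simp add: e'_def)
  have s2: "s * s = ip I r r" by (simp add: s_def ip_self_nonneg)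
  have r0: "r i = 0" if "s = 0" "i \<in> I" for i
    using ip_self_eq_0[OF I _ that(2), of r] that(1) s2 by simp
  have r_eq: "r i = s * e' m i" if "i \<in> I" for i
    using r0 that by (cases "s = 0") (auto simp: new)
  have orth: "ip I (e' m) (e j) = 0" if "j < m" for j
    using partial_onb_residual_orthogonal[OF I e that, of "b m"] unfolding r_def[symmetric] new ip_scale by simp
  have norm: "ip I (e' m) (e' m) \<in> {0, 1}"
    unfolding new ip_scale ip_scale_right s2[symmetric] by simp
  have span_old: "span_on I e' m = span_on I b m"
    using e old span_on_cong_basis[of m I e' e] by (simp add: partial_onb_def)
  have proj: "(\<lambda>i. \<Sum>j<m. ip I (b m) (e j) * e j i) \<in> span_on I b m"
  proof -
    have "(\<lambda>i. \<Sum>j<m. ip I (b m) (e j) * e j i) \<in> span_on I e m" by (rule span_onI) (rule refl)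
    then show ?thesis using e by (simp add: partial_onb_def)
  qed
  \<comment> \<open>On \<open>I\<close>, \<open>b m\<close> is \<open>s * e' m\<close> plus its
    projection onto the old span, also when \<open>s = 0\<close>. Exchanging the two therefore
    changes \<open>f\<close> only by an element of the old span.\<close>
  have "f \<in> span_on I e' (Suc m) \<longleftrightarrow> f \<in> span_on I b (Suc m)" for f
  proof
    assume "f \<in> span_on I e' (Suc m)"
    then obtain c where "(\<lambda>i. f i - c * e' m i) \<in> span_on I b m"
      by (auto simp: span_on_Suc span_old)
    from span_on_lincomb[OF this proj, of "- c / s"]
    have "(\<lambda>i. f i - (c / s) * b m i) \<in> span_on I b m"
      by (rule span_on_cong[THEN iffD1, rotated]) (simp add: new r_def diff_divide_distrib right_diff_distrib)
    then show "f \<in> span_on I b (Suc m)" unfolding span_on_Suc by (rule exI)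
  next
    assume "f \<in> span_on I b (Suc m)"
    then obtain c where "(\<lambda>i. f i - c * b m i) \<in> span_on I b m"
      by (auto simp: span_on_Suc)
    from span_on_lincomb[OF this proj, of c]
    have "(\<lambda>i. f i - (c * s) * e' m i) \<in> span_on I b m"
      by (rule span_on_cong[THEN iffD1, rotated])
        (simp add: r_eq[symmetric] mult.assoc, simp add: r_def algebra_simps)
    then show "f \<in> span_on I e' (Suc m)" unfolding span_on_Suc span_old by (rule exI)
  qed
  moreover have "ip I (e' j) (e' l) = 0" if jl: "j < Suc m" "l < Suc m" "j \<noteq> l" for j l
  proof -
    consider "j < m" "l < m" | "j = m" "l < m" | "j < m" "l = m" using jl by linarith
    then show ?thesis
      using e orth jl by cases (auto simp: old partial_onb_def ip_commute[of I "e _" "e' m"])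
  qed
  moreover have "ip I (e' j) (e' j) \<in> {0, 1}" if "j < Suc m" for j
    using that e norm by (cases "j = m") (auto simp: old partial_onb_def less_Suc_eq)
  ultimately have "partial_onb I b (Suc m) e'" unfolding partial_onb_def by blast
  then show ?case by (rule exI[of _ e'])
qed

section \<open>Projection, energy and residual sum of squares on one cell\<close>

locale local_fit =
  fixes b :: "nat \<Rightarrow> 'i \<Rightarrow> real" and m :: nat
begin

definition onb :: "'i set \<Rightarrow> nat \<Rightarrow> 'i \<Rightarrow> real" where
  "onb I = (SOME e. partial_onb I b m e)"

definition proj :: "'i set \<Rightarrow> ('i \<Rightarrow> real) \<Rightarrow> 'i \<Rightarrow> real" where
  "proj I f i = (\<Sum>j<m. ip I f (onb I j) * onb I j i)"

text \<open>The squared norm of the projection, by \<open>ip_proj_self\<close>. Written as a sum of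
  squared linear functionals, it is visibly measurable and has the form treated in
  \<open>std_gaussian_exp_energy\<close>.\<close>

definition energy :: "'i set \<Rightarrow> ('i \<Rightarrow> real) \<Rightarrow> real" where
  "energy I f = (\<Sum>j<m. (ip I f (onb I j))\<^sup>2)"

text \<open>The squared norm of the residual, by \<open>sq_residual_proj\<close>. As a difference of
  two quadratic forms it satisfies the parallelogram identity at once.\<close>

definition rss :: "'i set \<Rightarrow> ('i \<Rightarrow> real) \<Rightarrow> real" where
  "rss I f = ip I f f - energy I f"

lemma partial_onb_onb: "finite I \<Longrightarrow> partial_onb I b m (onb I)"
  unfolding onb_def using ex_partial_onb by (rule someI_ex)

lemma energy_nonneg: "0 \<le> energy I f"
  by (simp add: energy_def sum_nonneg)

lemma energy_scale: "energy I (\<lambda>i. c * f i) = c\<^sup>2 * energy I f"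
  by (simp add: energy_def ip_linear power_mult_distrib sum_distrib_left)

lemma rss_parallelogram:
  "rss I (\<lambda>i. f i + g i) + rss I (\<lambda>i. f i - g i) = 2 * rss I f + 2 * rss I g"
proof -
  have "energy I (\<lambda>i. f i + g i) + energy I (\<lambda>i. f i - g i) = 2 * energy I f + 2 * energy I g"
    unfolding energy_def sum_distrib_left sum.distrib[symmetric]
    by (intro sum.cong refl) (simp add: ip_linear power2_eq_square algebra_simps)
  then show ?thesis by (simp add: rss_def ip_linear)
qed

lemma proj_in_span:
  assumes "finite I" shows "proj I f \<in> span_on I b m"
proof -
  have "proj I f \<in> span_on I (onb I) m" by (rule span_onI) (rule proj_def)
  then show ?thesis using partial_onb_onb[OF assms] by (simp add: partial_onb_def)
qed

lemma residual_orthogonal: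
  assumes "finite I" "w \<in> span_on I b m"
  shows "ip I (\<lambda>i. f i - proj I f i) w = 0"
proof -
  have "w \<in> span_on I (onb I) m" using assms partial_onb_onb[of I] by (simp add: partial_onb_def)
  then obtain c where "\<forall>i\<in>I. w i = (\<Sum>j<m. c j * onb I j i)" by (auto simp: span_on_def)
  then have "ip I (\<lambda>i. f i - proj I f i) w = ip I (\<lambda>i. f i - proj I f i) (\<lambda>i. \<Sum>j<m. c j * onb I j i)"
    by (intro ip_cong) auto
  also have "\<dots> = (\<Sum>j<m. c j * ip I (\<lambda>i. f i - proj I f i) (onb I j))"
    by (simp only: ip_sum_right ip_scale_right)
  also have "\<dots> = 0"
    unfolding proj_def using partial_onb_residual_orthogonal[OF assms(1) partial_onb_onb[OF assms(1)]]
    by (intro sum.neutral) auto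
  finally show ?thesis .
qed

lemma ip_proj: "ip I (proj I f) g = (\<Sum>j<m. ip I f (onb I j) * ip I g (onb I j))"
  unfolding proj_def by (simp add: ip_linear ip_commute[of I "onb I _"])

lemma ip_proj_self:
  assumes "finite I" shows "ip I (proj I f) (proj I f) = energy I f"
proof -
  have "ip I (proj I f) (proj I f) = ip I f (proj I f)"
    using residual_orthogonal[OF assms proj_in_span[OF assms], of f f] by (simp add: ip_linear)
  then show ?thesis by (simp add: ip_commute[of I f] ip_proj energy_def power2_eq_square)
qed

lemma ip_proj_self_left: "ip I (proj I f) f = energy I f"
  by (simp add: ip_proj energy_def power2_eq_square)

lemma sq_residual_proj:
  assumes "finite I"
  shows "ip I (\<lambda>i. f i - proj I f i) (\<lambda>i. f i - proj I f i) = rss I f"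
proof -
  have "ip I (\<lambda>i. f i - proj I f i) (\<lambda>i. f i - proj I f i) = ip I (\<lambda>i. f i - proj I f i) f"
    by (subst ip_diff_right) (simp add: residual_orthogonal[OF assms proj_in_span[OF assms]])
  then show ?thesis by (simp add: ip_diff ip_proj_self_left rss_def)
qed

lemma rss_le:
  assumes "finite I" "v \<in> span_on I b m"
  shows "rss I f \<le> ip I (\<lambda>i. f i - v i) (\<lambda>i. f i - v i)"
proof -
  let ?u = "\<lambda>i. f i - proj I f i" and ?w = "\<lambda>i. proj I f i + (- 1) * v i"
  have "ip I ?u ?w = 0"
    by (intro residual_orthogonal span_on_lincomb proj_in_span assms)
  then have "ip I (\<lambda>i. ?u i + ?w i) (\<lambda>i. ?u i + ?w i) = ip I ?u ?u + ip I ?w ?w"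
    by (simp only: ip_add[of I ?u ?w] ip_add_right[of I _ ?u ?w] ip_commute[of I ?w ?u])
  then have "ip I (\<lambda>i. f i - v i) (\<lambda>i. f i - v i) = rss I f + ip I ?w ?w"
    by (simp add: sq_residual_proj[OF assms(1)])
  then show ?thesis using ip_self_nonneg[of I ?w] by linarith
qed

text \<open>The error is the projected noise minus the residual of the signal, and these two are
  orthogonal.\<close>

lemma loss_eq:
  assumes I: "finite I"
  shows "ip I (\<lambda>i. proj I (\<lambda>i. t i + f i) i - t i) (\<lambda>i. proj I (\<lambda>i. t i + f i) i - t i)
    = rss I t + energy I f"
proof -
  have "proj I (\<lambda>i. t i + f i) = (\<lambda>i. proj I t i + proj I f i)"
    by (simp add: fun_eq_iff proj_def ip_add distrib_right sum.distrib)
  then have "(\<lambda>i. proj I (\<lambda>i. t i + f i) i - t i) = (\<lambda>i. proj I f i - (t i - proj I t i))"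
    by (simp add: fun_eq_iff)
  moreover have "ip I (\<lambda>i. t i - proj I t i) (proj I f) = 0"
    by (rule residual_orthogonal[OF I proj_in_span[OF I]])
  ultimately show ?thesis
    using sq_residual_proj[OF I, of t] ip_proj_self[OF I, of f]
    by (simp only: ip_diff[of I "proj I f"] ip_diff_right[of I _ "proj I f"] ip_commute[of I "proj I f" "\<lambda>i. t i - proj I t i"])
qed

end

section \<open>Recursive partitions\<close>

text \<open>Dimension one enters through \<open>split_deterministic\<close>: with several
  coordinates to choose from, dyadic splitting would violate it.\<close>

locale binary_splitting =
  fixes split :: "'i set \<Rightarrow> 'i set \<Rightarrow> 'i set \<Rightarrow> bool"
  assumes split_union: "split R R1 R2 \<Longrightarrow> R = R1 \<union> R2"
    and split_disjoint: "split R R1 R2 \<Longrightarrow> R1 \<inter> R2 = {}"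
    and split_nonempty: "split R R1 R2 \<Longrightarrow> R1 \<noteq> {} \<and> R2 \<noteq> {}"
    and split_deterministic: "split R R1 R2 \<Longrightarrow> split R S1 S2 \<Longrightarrow> R1 = S1 \<and> R2 = S2"
begin

text \<open>Recursion from the root, in contrast to the leaf-by-leaf growth of
  \<open>split_partitions\<close>: inductions can treat the two children separately.\<close>

inductive tree_part :: "'i set \<Rightarrow> 'i set set \<Rightarrow> bool" where
  leaf: "R \<noteq> {} \<Longrightarrow> tree_part R {R}"
| node: "split R R1 R2 \<Longrightarrow> tree_part R1 P1 \<Longrightarrow> tree_part R2 P2 \<Longrightarrow> tree_part R (P1 \<union> P2)"

lemma tree_part_partition_on: "tree_part R P \<Longrightarrow> partition_on R P"
proof (induction rule: tree_part.induct)
  case (leaf R)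
  then show ?case by (simp add: partition_on_def disjoint_def)
next
  case (node R R1 R2 P1 P2)
  then show ?case
    using split_union[OF node.hyps(1)] split_disjoint[OF node.hyps(1)]
    by (auto simp: partition_on_def intro!: disjoint_union)
qed

lemma tree_part_nonempty:
  assumes "tree_part R P" shows "R \<noteq> {}" "P \<noteq> {}"
proof -
  show "R \<noteq> {}" using assms by cases (auto dest: split_union split_nonempty)
  then show "P \<noteq> {}" using tree_part_partition_on[OF assms] by (auto simp: partition_on_def)
qed

lemma tree_part_finite: "tree_part R P \<Longrightarrow> finite R \<Longrightarrow> finite P"
  using tree_part_partition_on finite_elements by blast

lemma tree_part_subset: "tree_part R P \<Longrightarrow> I \<in> P \<Longrightarrow> I \<subseteq> R"
  using tree_part_partition_on by (auto simp: partition_on_def)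

lemma tree_part_children_disjoint:
  assumes "split R R1 R2" "tree_part R1 P1" "tree_part R2 P2"
  shows "P1 \<inter> P2 = {}"
proof (rule ccontr)
  assume "P1 \<inter> P2 \<noteq> {}"
  then obtain I where I: "I \<in> P1" "I \<in> P2" by blast
  then have "I \<subseteq> R1 \<inter> R2" using assms tree_part_subset by blast
  moreover have "I \<noteq> {}" using I assms(2) tree_part_partition_on by (auto simp: partition_on_def)
  ultimately show False using split_disjoint[OF assms(1)] by auto
qed

lemma sum_tree_part_node:
  assumes "split R R1 R2" "tree_part R1 P1" "tree_part R2 P2" "finite R"
  shows "sum f (P1 \<union> P2) = sum f P1 + sum f P2"
  using assms tree_part_children_disjoint[OF assms(1-3)] split_union[OF assms(1)]
  by (intro sum.union_disjoint) (auto intro: tree_part_finite)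

lemma card_tree_part_node:
  assumes "split R R1 R2" "tree_part R1 P1" "tree_part R2 P2" "finite R"
  shows "card (P1 \<union> P2) = card P1 + card P2"
  using sum_tree_part_node[OF assms, of "\<lambda>_. 1 :: nat"] by simp

lemma finite_tree_parts: "finite R \<Longrightarrow> finite {P. tree_part R P}"
  by (rule finite_subset[of _ "Pow (Pow R)"]) (auto dest: tree_part_subset)

lemma card_tree_part_le: "tree_part R P \<Longrightarrow> finite R \<Longrightarrow> card P \<le> card R"
proof (induction rule: tree_part.induct)
  case (leaf R)
  then show ?case by (simp add: card_gt_0_iff Suc_le_eq)
next
  case (node R R1 R2 P1 P2)
  have fin: "finite R1" "finite R2" using node.prems split_union[OF node.hyps(1)] by auto
  have "card (P1 \<union> P2) \<le> card P1 + card P2" by (rule card_Un_le)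
  also have "\<dots> \<le> card R1 + card R2" using node.IH fin by (intro add_mono) auto
  also have "\<dots> = card R"
    using fin split_union[OF node.hyps(1)] split_disjoint[OF node.hyps(1)]
    by (simp add: card_Un_disjoint)
  finally show ?case .
qed

lemma tree_part_refine:
  assumes "tree_part R P" "S \<in> P" "tree_part S Q"
  shows "tree_part R (P - {S} \<union> Q)"
  using assms
proof (induction rule: tree_part.induct)
  case (leaf R)
  then show ?case by simp
next
  case (node R R1 R2 P1 P2)
  note disj = tree_part_children_disjoint[OF node.hyps]
  show ?case
  proof (cases "S \<in> P1")
    case True
    then have "P1 \<union> P2 - {S} \<union> Q = (P1 - {S} \<union> Q) \<union> P2" using disj by blast
    then show ?thesis using tree_part.node[OF node.hyps(1) node.IH(1)[OF True node.prems(2)] node.hyps(3)] by simp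
  next
    case False
    then have S: "S \<in> P2" using node.prems by blast
    then have "P1 \<union> P2 - {S} \<union> Q = P1 \<union> (P2 - {S} \<union> Q)" using disj by blast
    then show ?thesis using tree_part.node[OF node.hyps(1) node.hyps(2) node.IH(2)[OF S node.prems(2)]] by simp
  qed
qed

text \<open>A generating function of subtrees by number of leaves. Its value at a node is at most
  \<open>x\<close> plus the product of the values at the children, and the bound
  \<open>2 * x\<close> is inherited because \<open>4 * x\<^sup>2 \<le> x\<close> for
  \<open>x \<le> 1 / 4\<close>.\<close>

lemma sum_tree_parts_le:
  fixes x :: real
  assumes "finite R" "0 \<le> x" "x \<le> 1 / 4"
  shows "(\<Sum>Q | tree_part R Q. x ^ card Q) \<le> 2 * x"
  using assms(1)
proof (induction "card R" arbitrary: R rule: less_induct)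
  case less
  let ?T = "\<lambda>R. {Q. tree_part R Q}"
  show ?case
  proof (cases "\<exists>R1 R2. split R R1 R2")
    case False
    then have "?T R \<subseteq> {{R}}" by (auto elim: tree_part.cases)
    then have "(\<Sum>Q\<in>?T R. x ^ card Q) \<le> (\<Sum>Q\<in>{{R}}. x ^ card Q)"
      using assms by (intro sum_mono2) auto
    then show ?thesis using assms by simp
  next
    case True
    then obtain R1 R2 where sp: "split R R1 R2" by blast
    note R = split_union[OF sp] split_disjoint[OF sp] split_nonempty[OF sp]
    have fin: "finite R1" "finite R2" using less.prems R by auto
    have lt: "card R1 < card R" "card R2 < card R"
      using less.prems R by (auto intro!: psubset_card_mono)
    note IH = less.hyps[OF lt(1) fin(1)] less.hyps[OF lt(2) fin(2)]
    let ?U = "(\<lambda>(P1, P2). P1 \<union> P2) ` (?T R1 \<times> ?T R2)"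
    have finT: "finite (?T R1 \<times> ?T R2)" using fin by (simp add: finite_tree_parts)
    have "?T R \<subseteq> insert {R} ?U"
    proof
      fix Q assume "Q \<in> ?T R"
      then have "tree_part R Q" by simp
      then show "Q \<in> insert {R} ?U"
      proof cases
        case (node S1 S2 P1 P2)
        then show ?thesis using split_deterministic[OF sp node(2)] by auto
      qed simp
    qed
    then have "(\<Sum>Q\<in>?T R. x ^ card Q) \<le> (\<Sum>Q\<in>insert {R} ?U. x ^ card Q)"
      using assms finT by (intro sum_mono2) auto
    also have "\<dots> \<le> x + (\<Sum>Q\<in>?U. x ^ card Q)"
      using finT assms by (cases "{R} \<in> ?U") (simp_all add: insert_absorb)
    also have "(\<Sum>Q\<in>?U. x ^ card Q)
        \<le> sum ((\<lambda>Q. x ^ card Q) \<circ> (\<lambda>(P1, P2). P1 \<union> P2)) (?T R1 \<times> ?T R2)"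
      using finT assms by (intro sum_image_le) auto
    also have "\<dots> = (\<Sum>p\<in>?T R1 \<times> ?T R2. x ^ card (fst p) * x ^ card (snd p))"
      using card_tree_part_node[OF sp _ _ less.prems] by (intro sum.cong) (auto simp: power_add)
    also have "\<dots> = (\<Sum>Q\<in>?T R1. x ^ card Q) * (\<Sum>Q\<in>?T R2. x ^ card Q)"
      by (simp add: sum_product sum.cartesian_product split_beta)
    also have "\<dots> \<le> (2 * x) * (2 * x)"
      using IH assms by (intro mult_mono) (auto intro: sum_nonneg)
    also have "\<dots> \<le> x" using mult_mono[of "4 * x" 1 x x] assms by simp
    finally show ?thesis by simp
  qed
qed

text \<open>Serves the finitely many small \<open>n\<close>, where the penalty may be too weak for
  \<open>sum_tree_parts_le\<close>: there are at most \<open>2 ^ 2 ^ n\<close> families of subsets,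
  each of weight at most \<open>2 ^ n\<close>.\<close>

lemma sum_tree_parts_le_crude:
  fixes x :: real
  assumes "finite R" "0 \<le> x" "x \<le> 2" "card R \<le> n"
  shows "(\<Sum>Q | tree_part R Q. x ^ card Q) \<le> 2 ^ 2 ^ n * 2 ^ n"
proof -
  have "(\<Sum>Q | tree_part R Q. x ^ card Q) \<le> (\<Sum>Q | tree_part R Q. 2 ^ n)"
  proof (rule sum_mono)
    fix Q assume "Q \<in> {Q. tree_part R Q}"
    then have "card Q \<le> n" using card_tree_part_le[of R Q] assms by simp
    have "x ^ card Q \<le> 2 ^ card Q" using assms by (intro power_mono)
    also have "\<dots> \<le> 2 ^ n" using \<open>card Q \<le> n\<close> by (intro power_increasing) auto
    finally show "x ^ card Q \<le> 2 ^ n" .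
  qed
  also have "\<dots> = real (card {Q. tree_part R Q}) * 2 ^ n" by simp
  also have "card {Q. tree_part R Q} \<le> card (Pow (Pow R))"
    using assms by (intro card_mono) (auto dest: tree_part_subset)
  also have "card (Pow (Pow R)) \<le> 2 ^ 2 ^ n"
    using assms by (simp add: card_Pow power_increasing)
  finally show ?thesis by (simp add: mult_right_mono)
qed

end

section \<open>Deterministic comparison of the minimizer with a fixed tree partition\<close>

locale tree_fit = binary_splitting split + local_fit b m
  for split :: "'i set \<Rightarrow> 'i set \<Rightarrow> 'i set \<Rightarrow> bool" and b :: "nat \<Rightarrow> 'i \<Rightarrow> real" and m :: nat
begin

definition gain :: "'i set \<Rightarrow> 'i set set \<Rightarrow> ('i \<Rightarrow> real) \<Rightarrow> real" where
  "gain R P f = rss R f - (\<Sum>I\<in>P. rss I f)"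

lemma gain_nonneg:
  assumes R: "finite R" and P: "partition_on R P"
  shows "0 \<le> gain R P f"
proof -
  have "(\<Sum>I\<in>P. rss I f) \<le> (\<Sum>I\<in>P. ip I (\<lambda>i. f i - proj R f i) (\<lambda>i. f i - proj R f i))"
  proof (intro sum_mono rss_le)
    fix I assume "I \<in> P"
    then have "I \<subseteq> R" using P by (auto simp: partition_on_def)
    then show "finite I" "proj R f \<in> span_on I b m"
      using R finite_subset span_on_mono_set[OF proj_in_span[OF R]] by auto
  qed
  also have "\<dots> = rss R f"
    by (simp add: ip_partition[OF R P, symmetric] sq_residual_proj[OF R])
  finally show ?thesis by (simp add: gain_def)
qed

text \<open>With \<open>gain_nonneg\<close>, \<open>gain R P\<close> is a nonnegative quadratic form
  in the data. Dropping one square from the identity gives the two inequalities below, which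
  separate signal and noise at the cost of a factor 2.\<close>

lemma gain_parallelogram:
  "gain R P (\<lambda>i. f i + g i) + gain R P (\<lambda>i. f i - g i) = 2 * gain R P f + 2 * gain R P g"
proof -
  have "(\<Sum>I\<in>P. rss I (\<lambda>i. f i + g i)) + (\<Sum>I\<in>P. rss I (\<lambda>i. f i - g i))
      = (\<Sum>I\<in>P. 2 * rss I f + 2 * rss I g)"
    by (simp only: sum.distrib[symmetric] rss_parallelogram)
  then show ?thesis
    using rss_parallelogram[of R f g] by (simp add: gain_def sum.distrib sum_distrib_left)
qed

lemma gain_add_le:
  assumes "finite R" "partition_on R P"
  shows "gain R P (\<lambda>i. f i + g i) \<le> 2 * gain R P f + 2 * gain R P g"
  using gain_parallelogram[of R P f g] gain_nonneg[OF assms, of "\<lambda>i. f i - g i"] by linarith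

lemma gain_le_add:
  assumes "finite R" "partition_on R P"
  shows "gain R P f \<le> 2 * gain R P (\<lambda>i. f i + g i) + 2 * gain R P g"
  using gain_parallelogram[of R P "\<lambda>i. f i + g i" g] gain_nonneg[OF assms, of "\<lambda>i. f i + g i + g i"]
  by simp

lemma gain_eq_energy:
  assumes "finite R" "partition_on R P"
  shows "gain R P f = (\<Sum>I\<in>P. energy I f) - energy R f"
  using ip_partition[OF assms, of f f] by (simp add: gain_def rss_def sum_subtractf)

text \<open>Squared error of the cellwise fit to \<open>t + f\<close>, by \<open>loss_eq\<close>:
  squared bias plus projected noise.\<close>

definition loss :: "('i \<Rightarrow> real) \<Rightarrow> ('i \<Rightarrow> real) \<Rightarrow> 'i set set \<Rightarrow> real" where
  "loss t f P = (\<Sum>I\<in>P. rss I t + energy I f)"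

definition cost :: "('i \<Rightarrow> real) \<Rightarrow> real \<Rightarrow> 'i set set \<Rightarrow> real" where
  "cost y lam P = (\<Sum>I\<in>P. rss I y + lam)"

text \<open>The coefficients come from \<open>loss_refined_le\<close>: halving
  \<open>lam * card P / 2 \<le> 2 * gain t + 2 * gain f\<close> and inserting the result into
  \<open>gain f - gain t\<close> leaves twice the energy minus a quarter of the penalty.\<close>

definition noise :: "('i \<Rightarrow> real) \<Rightarrow> real \<Rightarrow> 'i set set \<Rightarrow> real" where
  "noise f lam P = (\<Sum>I\<in>P. 2 * energy I f - lam / 4)"

lemma loss_diff:
  assumes "finite R" "partition_on R P"
  shows "loss t f P - loss t f {R} = gain R P f - gain R P t"
  using gain_eq_energy[OF assms, of f] by (simp add: loss_def gain_def sum.distrib)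

text \<open>Preferring \<open>P\<close> to the single cell means that the data gain at least
  \<open>lam * (card P - 1)\<close>, hence at least \<open>lam * card P / 2\<close>. This gain stems
  from the signal or from the noise; unless the noise is large, the bias saved outweighs the added
  variance.\<close>

lemma loss_refined_le:
  assumes R: "finite R" "partition_on R P" and k: "2 \<le> card P" and lam: "0 \<le> lam"
    and opt: "cost (\<lambda>i. t i + f i) lam P \<le> cost (\<lambda>i. t i + f i) lam {R}"
  shows "loss t f P \<le> loss t f {R} + noise f lam P"
proof -
  have "lam * (real (card P) / 2) \<le> lam * (real (card P) - 1)"
    using k lam by (intro mult_left_mono) auto
  also have "\<dots> \<le> gain R P (\<lambda>i. t i + f i)"
    using opt by (simp add: cost_def gain_def sum.distrib algebra_simps)
  also have "\<dots> \<le> 2 * gain R P t + 2 * gain R P f" by (rule gain_add_le[OF R])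
  finally have "gain R P f - gain R P t \<le> 2 * gain R P f - lam * real (card P) / 4" by simp
  also have "\<dots> \<le> noise f lam P"
    using energy_nonneg[of R f]
    by (simp add: noise_def gain_eq_energy[OF R] sum_subtractf sum_distrib_left algebra_simps)
  finally show ?thesis using loss_diff[OF R, of t f] by linarith
qed

text \<open>Rejecting \<open>P\<close> means that the data gain at most \<open>lam * card P\<close>,
  so the bias lost is at most \<open>2 * lam * card P\<close> plus a multiple of the noise energy.
  Rewriting the energy through \<open>noise\<close> adds a quarter of \<open>lam * card P\<close>,
  and the factor 3 rounds up 9/4.\<close>

lemma loss_coarsened_le:
  assumes R: "finite R" "partition_on R P" and lam: "0 \<le> lam"
    and opt: "cost (\<lambda>i. t i + f i) lam {R} \<le> cost (\<lambda>i. t i + f i) lam P"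
  shows "loss t f {R} \<le> loss t f P + 3 * lam * real (card P) + noise f lam P"
proof -
  have "gain R P (\<lambda>i. t i + f i) \<le> lam * real (card P)"
    using opt lam by (simp add: cost_def gain_def sum.distrib algebra_simps)
  moreover have "gain R P f \<le> (\<Sum>I\<in>P. energy I f)"
    using energy_nonneg[of R f] by (simp add: gain_eq_energy[OF R])
  moreover have "gain R P t \<le> 2 * gain R P (\<lambda>i. t i + f i) + 2 * gain R P f"
    by (rule gain_le_add[OF R])
  moreover have "0 \<le> (\<Sum>I\<in>P. energy I f)" by (intro sum_nonneg energy_nonneg)
  moreover have "0 \<le> lam * real (card P)" using lam by simp
  moreover have "noise f lam P = 2 * (\<Sum>I\<in>P. energy I f) - lam * real (card P) / 4"
    by (simp add: noise_def sum_subtractf sum_distrib_left)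
  ultimately show ?thesis using loss_diff[OF R, of t f] by linarith
qed

text \<open>The list \<open>N\<close> is fixed before the data and the minimizer are quantified, so
  that expectations can later be taken node by node. The function \<open>F\<close> stands for any
  bound on the supremum of the noise over the subtrees below a cell.\<close>

definition excess_nodes :: "'i set \<Rightarrow> 'i set set \<Rightarrow> 'i set list \<Rightarrow> bool" where
  "excess_nodes R P N \<longleftrightarrow>
    (\<forall>t f lam F P'. 0 \<le> lam \<and> (\<forall>J\<subseteq>R. 0 \<le> F J) \<and>
        (\<forall>J\<subseteq>R. \<forall>Q. tree_part J Q \<longrightarrow> noise f lam Q \<le> F J) \<and> tree_part R P' \<and>
        (\<forall>Q. tree_part R Q \<longrightarrow> cost (\<lambda>i. t i + f i) lam P' \<le> cost (\<lambda>i. t i + f i) lam Q) \<longrightarrow>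
      loss t f P' \<le> loss t f P + 3 * lam * real (card P) + sum_list (map F N))"

lemma excess_nodesD:
  assumes "excess_nodes R P N" "0 \<le> lam" "\<forall>J\<subseteq>R. 0 \<le> F J"
    "\<forall>J\<subseteq>R. \<forall>Q. tree_part J Q \<longrightarrow> noise f lam Q \<le> F J" "tree_part R P'"
    "\<forall>Q. tree_part R Q \<longrightarrow> cost (\<lambda>i. t i + f i) lam P' \<le> cost (\<lambda>i. t i + f i) lam Q"
  shows "loss t f P' \<le> loss t f P + 3 * lam * real (card P) + sum_list (map F N)"
  using assms(1)[unfolded excess_nodes_def, rule_format, of lam F f P' t] assms(2-) by simp

lemma excess_nodesI:
  assumes "\<And>t f lam F P'. \<lbrakk>0 \<le> lam; \<forall>J\<subseteq>R. 0 \<le> F J;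
      \<forall>J\<subseteq>R. \<forall>Q. tree_part J Q \<longrightarrow> noise f lam Q \<le> F J; tree_part R P';
      \<forall>Q. tree_part R Q \<longrightarrow> cost (\<lambda>i. t i + f i) lam P' \<le> cost (\<lambda>i. t i + f i) lam Q\<rbrakk> \<Longrightarrow>
    loss t f P' \<le> loss t f P + 3 * lam * real (card P) + sum_list (map F N)"
  shows "excess_nodes R P N"
  unfolding excess_nodes_def by (intro allI impI, elim conjE, rule assms) assumption+

text \<open>The list consists of the nodes of the tree that generates \<open>P\<close>. Following that tree from
  the root, one reaches cells on which either the competitor or the minimizer stops splitting
  first; only at these cells the two have to be compared.\<close>

lemma ex_excess_nodes:
  assumes "tree_part R P" "finite R"
  shows "\<exists>N. length N < 2 * card P \<and> (\<forall>J\<in>set N. J \<subseteq> R) \<and> excess_nodes R P N"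
  using assms
proof (induction rule: tree_part.induct)
  case (leaf R)
  have "loss t f P' \<le> loss t f {R} + 3 * lam + F R"
    if "0 \<le> lam" "0 \<le> F R" and F: "\<forall>Q. tree_part R Q \<longrightarrow> noise f lam Q \<le> F R"
      and P': "tree_part R P'"
      and opt: "\<forall>Q. tree_part R Q \<longrightarrow> cost (\<lambda>i. t i + f i) lam P' \<le> cost (\<lambda>i. t i + f i) lam Q"
    for t f lam F P'
  proof (cases "P' = {R}")
    case True
    then show ?thesis using that by simp
  next
    case False
    \<comment> \<open>The minimizer splits a cell that the competitor keeps; two pieces are enough
      for the penalty argument of \<open>loss_refined_le\<close>.\<close>
    have "2 \<le> card P'"
      using P'
    proof cases
      case (node R1 R2 P1 P2)
      then have "card P1 > 0" "card P2 > 0"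
        using leaf.prems tree_part_nonempty tree_part_finite split_union[OF node(2)]
        by (auto simp: card_gt_0_iff)
      then show ?thesis using card_tree_part_node[OF node(2-4) leaf.prems] node(1) by simp
    qed (use False in simp)
    from loss_refined_le[OF leaf.prems tree_part_partition_on[OF P'] this \<open>0 \<le> lam\<close>, of t f]
    show ?thesis using opt F P' tree_part.leaf[OF leaf.hyps] \<open>0 \<le> lam\<close> by fastforce
  qed
  then have "excess_nodes R {R} [R]" unfolding excess_nodes_def by simp
  then show ?case by (intro exI[of _ "[R]"]) simp
next
  case (node R R1 R2 P1 P2)
  note sp = node.hyps(1)
  note R = split_union[OF sp]
  have fin: "finite R1" "finite R2" using node.prems R by auto
  have card: "card (P1 \<union> P2) = card P1 + card P2"
    by (rule card_tree_part_node[OF node.hyps node.prems])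
  obtain N1 where N1: "length N1 < 2 * card P1" "\<forall>J\<in>set N1. J \<subseteq> R1" "excess_nodes R1 P1 N1"
    using node.IH(1)[OF fin(1)] by blast
  obtain N2 where N2: "length N2 < 2 * card P2" "\<forall>J\<in>set N2. J \<subseteq> R2" "excess_nodes R2 P2 N2"
    using node.IH(2)[OF fin(2)] by blast
  let ?P = "P1 \<union> P2" and ?N = "R # N1 @ N2"
  have tp: "tree_part R ?P" by (rule tree_part.node[OF node.hyps])
  have sub: "\<forall>J\<in>set ?N. J \<subseteq> R" using N1(2) N2(2) R by auto
  have "loss t f P' \<le> loss t f ?P + 3 * lam * real (card ?P) + sum_list (map F ?N)"
    if lam: "0 \<le> lam" and F0: "\<forall>J\<subseteq>R. 0 \<le> F J"
      and F: "\<forall>J\<subseteq>R. \<forall>Q. tree_part J Q \<longrightarrow> noise f lam Q \<le> F J" and P': "tree_part R P'"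
      and opt: "\<forall>Q. tree_part R Q \<longrightarrow> cost (\<lambda>i. t i + f i) lam P' \<le> cost (\<lambda>i. t i + f i) lam Q"
    for t f lam F P'
    using P'
  proof cases
    \<comment> \<open>The minimizer stops at \<open>R\<close> while the competitor goes on; the
      noise of the competitor is charged to the node \<open>R\<close>.\<close>
    case leaf
    have "0 \<le> sum_list (map F (N1 @ N2))"
      using sub F0 by (intro sum_list_nonneg) auto
    moreover have "noise f lam ?P \<le> F R" using F tp by blast
    moreover have "loss t f P' \<le> loss t f ?P + 3 * lam * real (card ?P) + noise f lam ?P"
      using loss_coarsened_le[OF node.prems tree_part_partition_on[OF tp] lam, of t f] opt tp leaf
      by blast
    ultimately show ?thesis by simp
  next
    \<comment> \<open>Both split \<open>R\<close>, necessarily into the same children. Since the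
      cost is additive, exchanging one half while keeping the other shows that each half of the
      minimizer is optimal on its child.\<close>
    case (node S1 S2 Q1 Q2)
    with split_deterministic[OF sp] have Q: "tree_part R1 Q1" "tree_part R2 Q2" by auto
    note sum_node = sum_tree_part_node[OF sp _ _ node.prems]
    have F12: "\<forall>J\<subseteq>R1. 0 \<le> F J" "\<forall>J\<subseteq>R1. \<forall>Q. tree_part J Q \<longrightarrow> noise f lam Q \<le> F J"
      "\<forall>J\<subseteq>R2. 0 \<le> F J" "\<forall>J\<subseteq>R2. \<forall>Q. tree_part J Q \<longrightarrow> noise f lam Q \<le> F J"
      using F0 F R by auto
    have "\<forall>Q. tree_part R1 Q \<longrightarrow> cost (\<lambda>i. t i + f i) lam Q1 \<le> cost (\<lambda>i. t i + f i) lam Q"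
    proof (intro allI impI)
      fix Q' assume Q': "tree_part R1 Q'"
      show "cost (\<lambda>i. t i + f i) lam Q1 \<le> cost (\<lambda>i. t i + f i) lam Q'"
        using opt[rule_format, OF tree_part.node[OF sp Q' Q(2)]]
        unfolding node(1) cost_def sum_node[OF Q] sum_node[OF Q' Q(2)] by simp
    qed
    from excess_nodesD[OF N1(3) lam F12(1,2) Q(1) this]
    have 1: "loss t f Q1 \<le> loss t f P1 + 3 * lam * real (card P1) + sum_list (map F N1)" .
    have "\<forall>Q. tree_part R2 Q \<longrightarrow> cost (\<lambda>i. t i + f i) lam Q2 \<le> cost (\<lambda>i. t i + f i) lam Q"
    proof (intro allI impI)
      fix Q' assume Q': "tree_part R2 Q'"
      show "cost (\<lambda>i. t i + f i) lam Q2 \<le> cost (\<lambda>i. t i + f i) lam Q'"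
        using opt[rule_format, OF tree_part.node[OF sp Q(1) Q']]
        unfolding node(1) cost_def sum_node[OF Q] sum_node[OF Q(1) Q'] by simp
    qed
    from excess_nodesD[OF N2(3) lam F12(3,4) Q(2) this]
    have 2: "loss t f Q2 \<le> loss t f P2 + 3 * lam * real (card P2) + sum_list (map F N2)" .
    have "loss t f P' = loss t f Q1 + loss t f Q2" "loss t f ?P = loss t f P1 + loss t f P2"
      using sum_node Q node.hyps unfolding node(1) loss_def by blast+
    then show ?thesis using 1 2 F0[rule_format, of R] by (simp add: card algebra_simps)
  qed
  then have "excess_nodes R ?P ?N" by (rule excess_nodesI)
  then show ?case
    using sub N1(1) N2(1) by (intro exI[of _ ?N]) (simp add: card)
qed

end

section \<open>Expected supremum of the noise over subtrees\<close>

context tree_fit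
begin

lemma energy_measurable:
  assumes "finite I" shows "energy I \<in> borel_measurable (Pi\<^sub>M I (\<lambda>_. borel))"
  unfolding energy_def ip_def by measurable

lemma energy_restrict: "energy I (restrict f I) = energy I f"
  by (simp add: energy_def ip_def)

lemma onb_norms:
  assumes "finite I" "j < m" shows "(\<Sum>i\<in>I. (onb I j i)\<^sup>2) \<in> {0, 1}"
  using partial_onb_onb[OF assms(1)] assms(2) by (simp add: partial_onb_def ip_def power2_eq_square)

text \<open>Exponentiating and summing over all tree partitions bounds the supremum of the noise.
  The scale is the one at which the energy of each cell still has an exponential moment.\<close>

definition noise_majorant :: "real \<Rightarrow> real \<Rightarrow> 'i set \<Rightarrow> ('i \<Rightarrow> real) \<Rightarrow> real" where
  "noise_majorant \<sigma> lam J z = 8 * real m * \<sigma>\<^sup>2 *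
     (\<Sum>Q | tree_part J Q. \<Prod>I\<in>Q. exp (energy I z / (4 * real m)) * exp (- lam / (32 * real m * \<sigma>\<^sup>2)))"

lemma noise_majorant_nonneg: "0 \<le> noise_majorant \<sigma> lam J z"
  by (simp add: noise_majorant_def sum_nonneg prod_nonneg)

text \<open>After rescaling by \<open>?c\<close>, the inequality \<open>x \<le> exp x\<close> makes
  every term positive, and then the sum over all tree partitions dominates the term of
  \<open>Q\<close>.\<close>

lemma noise_le_majorant:
  assumes "finite J" "tree_part J Q" "0 < m" "0 < \<sigma>"
  shows "noise (\<lambda>i. \<sigma> * z i) lam Q \<le> noise_majorant \<sigma> lam J z"
proof -
  let ?c = "8 * real m * \<sigma>\<^sup>2"
  let ?x = "\<lambda>I. energy I z / (4 * real m) + - lam / (32 * real m * \<sigma>\<^sup>2)"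
  have c: "0 < ?c" using assms by simp
  have eq: "2 * energy I (\<lambda>i. \<sigma> * z i) - lam / 4 = ?c * ?x I" for I
    using assms by (simp add: energy_scale field_simps)
  have "noise (\<lambda>i. \<sigma> * z i) lam Q = ?c * (\<Sum>I\<in>Q. ?x I)"
    unfolding noise_def eq by (simp only: sum_distrib_left)
  also have "(\<Sum>I\<in>Q. ?x I) \<le> exp (\<Sum>I\<in>Q. ?x I)"
    using exp_ge_add_one_self[of "\<Sum>I\<in>Q. ?x I"] by linarith
  also have "\<dots> = (\<Prod>I\<in>Q. exp (energy I z / (4 * real m)) * exp (- lam / (32 * real m * \<sigma>\<^sup>2)))"
    using tree_part_finite[OF assms(2,1)] by (simp only: exp_sum exp_add)
  also have "\<dots> \<le> (\<Sum>Q | tree_part J Q. \<Prod>I\<in>Q. exp (energy I z / (4 * real m)) * exp (- lam / (32 * real m * \<sigma>\<^sup>2)))"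
    using assms by (intro member_le_sum) (auto simp: finite_tree_parts prod_nonneg)
  finally show ?thesis
    using c by (simp add: noise_majorant_def mult_left_mono)
qed

text \<open>The pieces of a tree partition are disjoint, so their exponentiated energies are
  independent and each contributes a factor of at most \<open>sqrt 2\<close>. What remains is the
  generating function of subtrees.\<close>

lemma noise_majorant_integral:
  fixes G :: "'i set"
  assumes G: "finite G" and J: "J \<subseteq> G" and m: "0 < m"
  shows "integrable (std_gaussian G) (noise_majorant \<sigma> lam J)"
    and "(LINT z|std_gaussian G. noise_majorant \<sigma> lam J z)
      \<le> 8 * real m * \<sigma>\<^sup>2 *
        (\<Sum>Q | tree_part J Q. (sqrt 2 * exp (- lam / (32 * real m * \<sigma>\<^sup>2))) ^ card Q)"
proof -
  let ?k = "exp (- lam / (32 * real m * \<sigma>\<^sup>2))"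
  let ?f = "\<lambda>I z. exp (energy I z / (4 * real m)) * ?k"
  have finJ: "finite J" using G J finite_subset by blast
  have blocks: "integrable (std_gaussian G) (\<lambda>z. \<Prod>I\<in>Q. ?f I z) \<and>
      (LINT z|std_gaussian G. (\<Prod>I\<in>Q. ?f I z)) \<le> (sqrt 2 * ?k) ^ card Q"
    if Q: "tree_part J Q" for Q
  proof -
    have IG: "finite I" "I \<subseteq> G" if "I \<in> Q" for I
      using tree_part_subset[OF Q that] J finJ finite_subset by auto
    have cell: "integrable (std_gaussian G) (\<lambda>z. exp (energy I z / (4 * real m))) \<and>
        (LINT z|std_gaussian G. exp (energy I z / (4 * real m))) \<le> sqrt 2" if "I \<in> Q" for I
      using std_gaussian_exp_energy[OF G IG(2)[OF that] m onb_norms[OF IG(1)[OF that]]]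
      by (simp add: energy_def ip_def)
    have intf: "integrable (std_gaussian G) (?f I)" if "I \<in> Q" for I
      using cell[OF that] by (intro integrable_mult_left) simp
    have meas: "?f I \<in> borel_measurable (Pi\<^sub>M I (\<lambda>_. borel))" if "I \<in> Q" for I
      using energy_measurable[OF IG(1)[OF that]] by measurable
    have finQ: "finite Q" by (rule tree_part_finite[OF Q finJ])
    have disj: "disjoint Q" using tree_part_partition_on[OF Q] by (simp add: partition_on_def)
    note B = std_gaussian_prod_blocks[of G Q ?f, OF G finQ IG(2) disj meas _ intf]
    have "(LINT z|std_gaussian G. (\<Prod>I\<in>Q. ?f I z)) = (\<Prod>I\<in>Q. (LINT z|std_gaussian G. ?f I z))"
      by (rule B(2)) (simp_all add: energy_restrict)
    also have "\<dots> \<le> (\<Prod>I\<in>Q. sqrt 2 * ?k)"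
      using cell by (intro prod_mono) (auto intro!: mult_right_mono mult_nonneg_nonneg Bochner_Integration.integral_nonneg)
    finally show ?thesis
      by (intro conjI B(1)) (simp_all add: energy_restrict)
  qed
  have int: "integrable (std_gaussian G) (\<lambda>z. \<Sum>Q | tree_part J Q. \<Prod>I\<in>Q. ?f I z)"
    using blocks by (intro Bochner_Integration.integrable_sum) auto
  then show "integrable (std_gaussian G) (noise_majorant \<sigma> lam J)"
    unfolding noise_majorant_def by (intro integrable_mult_right)
  have "(LINT z|std_gaussian G. noise_majorant \<sigma> lam J z) = 8 * real m * \<sigma>\<^sup>2 *
      (\<Sum>Q | tree_part J Q. (LINT z|std_gaussian G. (\<Prod>I\<in>Q. ?f I z)))"
    unfolding noise_majorant_def using blocks
    by (subst integral_mult_right_zero) (simp add: Bochner_Integration.integral_sum)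
  also have "\<dots> \<le> 8 * real m * \<sigma>\<^sup>2 * (\<Sum>Q | tree_part J Q. (sqrt 2 * ?k) ^ card Q)"
    using blocks by (intro mult_left_mono sum_mono) auto
  finally show "(LINT z|std_gaussian G. noise_majorant \<sigma> lam J z)
      \<le> 8 * real m * \<sigma>\<^sup>2 * (\<Sum>Q | tree_part J Q. (sqrt 2 * ?k) ^ card Q)" .
qed

text \<open>One integrable function dominates the loss of every minimizer, which bypasses the
  measurability of the selected partition.\<close>

lemma ex_integrable_loss_bound:
  assumes R: "finite R" and P: "tree_part R P" and m: "0 < m" and \<sigma>: "0 < \<sigma>" and lam: "0 \<le> lam"
    and A: "\<And>J. J \<subseteq> R \<Longrightarrow>
      (\<Sum>Q | tree_part J Q. (sqrt 2 * exp (- lam / (32 * real m * \<sigma>\<^sup>2))) ^ card Q) \<le> A"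
  shows "\<exists>g. integrable (std_gaussian R) g \<and>
    (LINT z|std_gaussian R. g z) \<le> (\<Sum>I\<in>P. rss I t) + (4 * lam + 16 * real m * \<sigma>\<^sup>2 * A) * real (card P) \<and>
    (\<forall>z P'. tree_part R P' \<longrightarrow>
      (\<forall>Q. tree_part R Q \<longrightarrow> cost (\<lambda>i. t i + \<sigma> * z i) lam P' \<le> cost (\<lambda>i. t i + \<sigma> * z i) lam Q) \<longrightarrow>
      loss t (\<lambda>i. \<sigma> * z i) P' \<le> g z)"
proof -
  interpret gauss: prob_space "std_gaussian R" by (rule prob_space_std_gaussian)
  obtain N where N: "length N < 2 * card P" "\<forall>J\<in>set N. J \<subseteq> R" "excess_nodes R P N"
    using ex_excess_nodes[OF P R] by blast
  let ?F = "\<lambda>z J. noise_majorant \<sigma> lam J z"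
  let ?a = "(\<Sum>I\<in>P. rss I t) + 4 * lam * real (card P)"
  let ?A = "8 * real m * \<sigma>\<^sup>2 * A"
  \<comment> \<open>The additional \<open>R\<close> pays for the noise in the loss of
    \<open>P\<close> itself, and the strict bound on \<open>length N\<close> leaves room for it. The
    fourth multiple of \<open>lam * card P\<close> in \<open>?a\<close> absorbs the penalty
    contained in that noise term.\<close>
  define g where "g z = ?a + sum_list (map (?F z) (R # N))" for z
  have F: "integrable (std_gaussian R) (\<lambda>z. ?F z J)" "(LINT z|std_gaussian R. ?F z J) \<le> ?A"
    if "J \<subseteq> R" for J
  proof -
    show "integrable (std_gaussian R) (\<lambda>z. ?F z J)" by (rule noise_majorant_integral(1)[OF R that m])
    show "(LINT z|std_gaussian R. ?F z J) \<le> ?A"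
      using A[OF that] by (intro order_trans[OF noise_majorant_integral(2)[OF R that m]] mult_left_mono) auto
  qed
  have A0: "0 \<le> ?A"
    using order_trans[OF Bochner_Integration.integral_nonneg F(2)[of R]] by (simp add: noise_majorant_nonneg)
  have list: "integrable (std_gaussian R) (\<lambda>z. sum_list (map (?F z) L)) \<and>
      (LINT z|std_gaussian R. sum_list (map (?F z) L)) \<le> ?A * real (length L)"
    if "\<forall>J\<in>set L. J \<subseteq> R" for L
    using that
  proof (induction L)
    case (Cons J L)
    then show ?case using F[of J] by (simp add: algebra_simps)
  qed simp
  have RN: "\<forall>J\<in>set (R # N). J \<subseteq> R" using N(2) by simp
  have int: "integrable (std_gaussian R) g"
    unfolding g_def using list[OF RN] by (intro Bochner_Integration.integrable_add) auto
  have "(LINT z|std_gaussian R. g z) = ?a + (LINT z|std_gaussian R. sum_list (map (?F z) (R # N)))"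
    unfolding g_def using list[OF RN]
    by (subst Bochner_Integration.integral_add) (auto simp: gauss.prob_space)
  also have "\<dots> \<le> ?a + ?A * real (length (R # N))" using list[OF RN] by simp
  also have "\<dots> \<le> ?a + ?A * (2 * real (card P))"
    using N(1) A0 by (intro add_left_mono mult_left_mono) auto
  finally have "(LINT z|std_gaussian R. g z)
      \<le> (\<Sum>I\<in>P. rss I t) + (4 * lam + 16 * real m * \<sigma>\<^sup>2 * A) * real (card P)"
    by (simp add: algebra_simps)
  moreover have "loss t (\<lambda>i. \<sigma> * z i) P' \<le> g z"
    if "tree_part R P'"
      "\<forall>Q. tree_part R Q \<longrightarrow> cost (\<lambda>i. t i + \<sigma> * z i) lam P' \<le> cost (\<lambda>i. t i + \<sigma> * z i) lam Q" for z P'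
  proof -
    have le: "\<forall>J\<subseteq>R. \<forall>Q. tree_part J Q \<longrightarrow> noise (\<lambda>i. \<sigma> * z i) lam Q \<le> ?F z J"
      using noise_le_majorant m \<sigma> R finite_subset by blast
    have "loss t (\<lambda>i. \<sigma> * z i) P' \<le> loss t (\<lambda>i. \<sigma> * z i) P + 3 * lam * real (card P) + sum_list (map (?F z) N)"
      by (rule excess_nodesD[OF N(3) lam _ le that]) (simp add: noise_majorant_nonneg)
    moreover have "loss t (\<lambda>i. \<sigma> * z i) P
        = (\<Sum>I\<in>P. rss I t) + (noise (\<lambda>i. \<sigma> * z i) lam P + lam * real (card P) / 4) / 2"
      by (simp add: loss_def noise_def sum.distrib sum_subtractf sum_distrib_left[symmetric])
    moreover have "noise (\<lambda>i. \<sigma> * z i) lam P \<le> ?F z R" using le P by blast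
    moreover have "0 \<le> ?F z R" "0 \<le> lam * real (card P)" using lam by (simp_all add: noise_majorant_nonneg)
    ultimately show ?thesis by (simp add: g_def mult.assoc) argo
  qed
  ultimately show ?thesis using int by (intro exI[of _ g]) blast
qed

end

section \<open>Dyadic partitions of an interval\<close>

abbreviation cell :: "nat \<Rightarrow> nat \<Rightarrow> nat list set" where
  "cell a b \<equiv> (\<lambda>k. [k]) ` {a..b}"

lemma grid_box_1: "grid_box [a] [b] = cell a b"
  by (auto simp: grid_box_def list_all2_Cons1)

lemma grid_1: "grid 1 n = cell 1 n"
  by (auto simp: grid_def length_Suc_conv)

lemma cell_eq_iff: "a \<le> b \<Longrightarrow> cell a b = cell a' b' \<longleftrightarrow> a = a' \<and> b = b'"
  by (subst inj_image_eq_iff) (auto simp: inj_def Icc_eq_Icc)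

lemma cell_subset_grid: "a \<le> b \<Longrightarrow> cell a b \<subseteq> grid 1 n \<longleftrightarrow> 1 \<le> a \<and> b \<le> n"
  unfolding grid_1 by (subst inj_image_subset_iff) (auto simp: inj_def)

lemmas grid_1_simps = grid_1 grid_1[unfolded One_nat_def]

lemmas cell_subset_grid_simps = cell_subset_grid cell_subset_grid[unfolded One_nat_def]

lemma grid_box_subset_grid_1:
  assumes "grid_box a b \<noteq> {}" "grid_box a b \<subseteq> grid 1 n"
  obtains a' b' where "a = [a']" "b = [b']" "a' \<le> b'"
proof -
  obtain x where x: "x \<in> grid_box a b" using assms by blast
  then have "length x = 1" "length a = length x" "length b = length x"
    using assms by (auto simp: grid_def grid_box_def list_all2_lengthD)
  then obtain x' a' b' where "x = [x']" "a = [a']" "b = [b']"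
    by (auto simp: length_Suc_conv)
  with x that show thesis by (auto simp: grid_box_def)
qed

lemma is_rectangle_1E:
  assumes "is_rectangle 1 n J"
  obtains a b where "J = cell a b"
  using assms grid_box_subset_grid_1 unfolding is_rectangle_def by (metis grid_box_1)

text \<open>Confining the parent to \<open>grid 1 n\<close> forces index lists of length one, for
  which the dyadic split is unique.\<close>

definition dyadic_split_1 :: "nat \<Rightarrow> nat list set \<Rightarrow> nat list set \<Rightarrow> nat list set \<Rightarrow> bool" where
  "dyadic_split_1 n R R1 R2 \<longleftrightarrow> R \<subseteq> grid 1 n \<and> dyadic_split R R1 R2"

text \<open>In an interval with an odd number of points the middle one goes to the left child, in
  agreement with rounding the midpoint down.\<close>

lemma dyadic_midpoint:
  assumes "a < b"
  shows "int l = int a - 1 + \<lceil>(real b - real a + 1) / 2\<rceil> \<longleftrightarrow> l = (a + b) div 2"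
proof -
  have "\<lceil>(real b - real a + 1) / 2\<rceil> = - (- (int b - int a + 1) div 2)"
    using ceiling_divide_eq_div[of "int b - int a + 1" 2, where 'a = real] by simp
  then show ?thesis using assms by presburger
qed

lemma dyadic_split_1_iff:
  "dyadic_split_1 n R R1 R2 \<longleftrightarrow> (\<exists>a b. a < b \<and> 1 \<le> a \<and> b \<le> n \<and> R = cell a b \<and>
     R1 = cell a ((a + b) div 2) \<and> R2 = cell (Suc ((a + b) div 2)) b)"
proof
  assume asm: "dyadic_split_1 n R R1 R2"
  then obtain a b j l where *: "R \<subseteq> grid 1 n" "R = grid_box a b" "R \<noteq> {}" "j < length a"
    "a ! j < b ! j" "int l = int (a ! j) - 1 + \<lceil>(real (b ! j) - real (a ! j) + 1) / 2\<rceil>"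
    "R1 = grid_box a (b[j := l])" "R2 = grid_box (a[j := l + 1]) b"
    unfolding dyadic_split_1_def dyadic_split_def by blast
  obtain a' b' where ab: "a = [a']" "b = [b']" "a' \<le> b'"
    using grid_box_subset_grid_1[of a b n] *(1-3) by blast
  have "l = (a' + b') div 2" using dyadic_midpoint[of a' b' l] * ab by simp
  moreover have "1 \<le> a'" "b' \<le> n" using *(1,2) ab by (auto simp: grid_box_1 cell_subset_grid_simps)
  ultimately show "\<exists>a b. a < b \<and> 1 \<le> a \<and> b \<le> n \<and> R = cell a b \<and>
     R1 = cell a ((a + b) div 2) \<and> R2 = cell (Suc ((a + b) div 2)) b"
    using * ab by (intro exI[of _ a'] exI[of _ b']) (simp add: grid_box_1)
next
  assume "\<exists>a b. a < b \<and> 1 \<le> a \<and> b \<le> n \<and> R = cell a b \<and>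
     R1 = cell a ((a + b) div 2) \<and> R2 = cell (Suc ((a + b) div 2)) b"
  then obtain a b where *: "a < b" "1 \<le> a" "b \<le> n" "R = cell a b"
     "R1 = cell a ((a + b) div 2)" "R2 = cell (Suc ((a + b) div 2)) b" by blast
  have "R \<subseteq> grid 1 n" using * by (simp add: cell_subset_grid_simps)
  moreover have "dyadic_split R R1 R2"
    unfolding dyadic_split_def
    using * dyadic_midpoint[of a b "(a + b) div 2"]
    by (intro exI[of _ "[a]"] exI[of _ "[b]"] exI[of _ 0] exI[of _ "(a + b) div 2"])
      (simp add: grid_box_1)
  ultimately show "dyadic_split_1 n R R1 R2" by (simp add: dyadic_split_1_def)
qed

global_interpretation dyadic: binary_splitting "dyadic_split_1 n" for n
proof
  fix R R1 R2 assume "dyadic_split_1 n R R1 R2"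
  then obtain a b where *: "a < b" "R = cell a b"
     "R1 = cell a ((a + b) div 2)" "R2 = cell (Suc ((a + b) div 2)) b"
    by (auto simp: dyadic_split_1_iff)
  have "{a..b} = {a..(a + b) div 2} \<union> {Suc ((a + b) div 2)..b}" using *(1) by auto
  then show "R = R1 \<union> R2" using * by (simp add: image_Un[symmetric])
  show "R1 \<inter> R2 = {}" "R1 \<noteq> {} \<and> R2 \<noteq> {}" using * by auto
  fix S1 S2 assume "dyadic_split_1 n R S1 S2"
  then show "R1 = S1 \<and> R2 = S2" using * by (auto simp: dyadic_split_1_iff cell_eq_iff)
qed

lemma split_partitions_tree_part:
  assumes n: "1 \<le> n"
  shows "split_partitions dyadic_split 1 n = {P. dyadic.tree_part n (grid 1 n) P}"
proof -
  have 1: "dyadic.tree_part n (grid 1 n) P" if "P \<in> split_partitions dyadic_split 1 n" for P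
    using that
  proof (induction rule: split_partitions.induct)
    case start
    show ?case using n by (intro dyadic.tree_part.leaf) (simp add: grid_1_simps)
  next
    case (step P R R1 R2)
    then have "dyadic_split_1 n R R1 R2"
      using dyadic.tree_part_subset[OF step.IH step.hyps(2)] by (simp add: dyadic_split_1_def)
    then have "dyadic.tree_part n R ({R1} \<union> {R2})"
      using dyadic.split_nonempty[of n R R1 R2]
      by (intro dyadic.tree_part.node[of n R R1 R2] dyadic.tree_part.leaf) auto
    from dyadic.tree_part_refine[OF step.IH step.hyps(2) this] show ?case
      by (simp add: insert_commute)
  qed
  \<comment> \<open>Grafting onto a block of an arbitrary reachable partition is the form that
    survives the induction: the left subtree is grafted first, then the right one onto the
    result.\<close>
  have "P - {R} \<union> Q \<in> split_partitions dyadic_split 1 n"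
    if "dyadic.tree_part n R Q" "P \<in> split_partitions dyadic_split 1 n" "R \<in> P" for P Q R
    using that
  proof (induction arbitrary: P rule: dyadic.tree_part.induct)
    case (leaf R)
    then show ?case by (simp add: insert_absorb)
  next
    case (node R R1 R2 P1 P2)
    note sp = node.hyps(1)
    note R = dyadic.split_union[OF sp] dyadic.split_disjoint[OF sp] dyadic.split_nonempty[OF sp]
    have part: "partition_on (grid 1 n) P"
      by (rule dyadic.tree_part_partition_on[OF 1[OF node.prems(1)]])
    \<comment> \<open>Blocks are disjoint, so no proper nonempty part of \<open>R\<close> is already
      a block; removing \<open>R1\<close> and \<open>R2\<close> later deletes nothing else.\<close>
    have notin: "S \<notin> P" if "S \<subseteq> R" "S \<noteq> {}" "S \<noteq> R" for S
      using part node.prems(2) that unfolding partition_on_def disjoint_def by blast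
    have new: "R1 \<notin> P" "R2 \<notin> P" "R1 \<noteq> R2" using notin R by blast+
    have "R2 \<notin> P1"
      using dyadic.tree_part_subset[OF node.hyps(2)] R by blast
    let ?P' = "P - {R} \<union> {R1, R2}"
    have "?P' \<in> split_partitions dyadic_split 1 n"
      using node.prems sp by (intro split_partitions.step) (simp_all add: dyadic_split_1_def)
    then have "?P' - {R1} \<union> P1 \<in> split_partitions dyadic_split 1 n"
      by (rule node.IH(1)) simp
    then have "?P' - {R1} \<union> P1 - {R2} \<union> P2 \<in> split_partitions dyadic_split 1 n"
      by (rule node.IH(2)) (use new in simp)
    moreover have "?P' - {R1} \<union> P1 - {R2} \<union> P2 = P - {R} \<union> (P1 \<union> P2)"
      using new \<open>R2 \<notin> P1\<close> by blast
    ultimately show ?case by simp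
  qed
  from this[OF _ split_partitions.start, of "grid 1 n"]
  have 2: "Q \<in> split_partitions dyadic_split 1 n" if "dyadic.tree_part n (grid 1 n) Q" for Q
    using that by simp
  show ?thesis using 1 2 by blast
qed

text \<open>An interval that meets both sides of the cut contains \<open>x\<close>, and only one
  block of a partition does. Hence at most one block is counted twice.\<close>

lemma touching_cells_split:
  assumes P: "partition_on (grid 1 n) P" "\<And>J. J \<in> P \<Longrightarrow> is_rectangle 1 n J"
    and x: "1 \<le> x" "x \<le> n"
  shows "card {J \<in> P. J \<inter> cell a x \<noteq> {}} + card {J \<in> P. J \<inter> cell (Suc x) b \<noteq> {}}
    \<le> card {J \<in> P. J \<inter> (cell a x \<union> cell (Suc x) b) \<noteq> {}} + 1"
proof -
  let ?A = "{J \<in> P. J \<inter> cell a x \<noteq> {}}" and ?B = "{J \<in> P. J \<inter> cell (Suc x) b \<noteq> {}}"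
  have fin: "finite P" using P(1) by (rule finite_elements[rotated]) (simp add: grid_1_simps)
  have "[x] \<in> grid 1 n" using x by (simp add: grid_1_simps)
  then obtain J0 where J0: "J0 \<in> P" "[x] \<in> J0" using P(1) by (auto simp: partition_on_def)
  have "?A \<inter> ?B \<subseteq> {J0}"
  proof
    fix J assume J: "J \<in> ?A \<inter> ?B"
    obtain c d where cd: "J = cell c d" using J P(2) by (blast elim: is_rectangle_1E)
    then have "[x] \<in> J" using J by auto
    then show "J \<in> {J0}" using J J0 P(1) unfolding partition_on_def disjoint_def by blast
  qed
  then have "card (?A \<inter> ?B) \<le> 1" using card_mono[of "{J0}"] by simp
  moreover have "card ?A + card ?B = card (?A \<union> ?B) + card (?A \<inter> ?B)"
    using fin by (intro card_Un_Int) auto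
  moreover have "?A \<union> ?B = {J \<in> P. J \<inter> (cell a x \<union> cell (Suc x) b) \<noteq> {}}" by blast
  ultimately show ?thesis by simp
qed

text \<open>The tree is split completely down to depth \<open>j\<close>, and below only along the
  paths to the end points of the given pieces.\<close>

lemma ex_tree_part_refining:
  assumes P: "partition_on (grid 1 n) P" "\<And>J. J \<in> P \<Longrightarrow> is_rectangle 1 n J"
  shows "\<lbrakk>1 \<le> a; a \<le> b; b \<le> n; b - a < 2 ^ L; j \<le> L\<rbrakk> \<Longrightarrow>
    \<exists>Q. dyadic.tree_part n (cell a b) Q \<and> (\<forall>I\<in>Q. \<exists>J\<in>P. I \<subseteq> J) \<and>
      card Q \<le> 2 ^ j + (card {J \<in> P. J \<inter> cell a b \<noteq> {}} - 1) * (L - j)"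
proof (induction L arbitrary: a b j)
  case 0
  have "[a] \<in> grid 1 n" using 0 by (auto simp: grid_1_simps)
  then obtain J where "J \<in> P" "[a] \<in> J" using P(1) by (auto simp: partition_on_def)
  then show ?case using 0
    by (intro exI[of _ "{cell a b}"]) (auto intro!: dyadic.tree_part.leaf)
next
  case (Suc L)
  let ?T = "\<lambda>R. {J \<in> P. J \<inter> R \<noteq> {}}"
  have fin: "finite P" using P(1) by (rule finite_elements[rotated]) (simp add: grid_1_simps)
  have touch: "?T R \<noteq> {}" if "R \<noteq> {}" "R \<subseteq> grid 1 n" for R
    using that P(1) by (fastforce simp: partition_on_def)
  have sub: "cell a b \<subseteq> grid 1 n" using Suc.prems by (simp add: cell_subset_grid_simps)
  show ?case
  \<comment> \<open>A cell that meets a single piece lies inside it and stays a leaf, which costs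
    one piece and is covered by \<open>2 ^ j\<close>.\<close>
  proof (cases "card (?T (cell a b)) \<le> 1")
    case True
    moreover have "card (?T (cell a b)) \<noteq> 0" using touch[of "cell a b"] sub Suc.prems fin by simp
    ultimately have "card (?T (cell a b)) = 1" by simp
    then obtain J where J: "?T (cell a b) = {J}" by (auto simp: card_1_singleton_iff)
    have "cell a b \<subseteq> J"
    proof
      fix x assume "x \<in> cell a b"
      moreover then obtain J' where "J' \<in> P" "x \<in> J'" using sub P(1) by (auto simp: partition_on_def)
      ultimately have "J' \<in> ?T (cell a b)" by blast
      then show "x \<in> J" using J \<open>x \<in> J'\<close> by simp
    qed
    moreover have "J \<in> P" using J by blast
    moreover have "1 \<le> 2 ^ j + x" for x :: nat by (rule trans_le_add1) simp
    ultimately show ?thesis using Suc.prems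
      by (intro exI[of _ "{cell a b}"] conjI dyadic.tree_part.leaf) auto
  next
    case False
    let ?x = "(a + b) div 2"
    have "a \<noteq> b"
    proof
      assume "a = b"
      then have "J = J'" if "J \<in> ?T (cell a b)" "J' \<in> ?T (cell a b)" for J J'
        using that disjointD[OF partition_onD2[OF P(1)], of J J'] by auto
      then have "card (?T (cell a b)) \<le> 1"
        unfolding One_nat_def using fin by (subst card_le_Suc0_iff_eq) auto
      then show False using False by simp
    qed
    then have ab: "a < b" using Suc.prems by simp
    have split: "dyadic_split_1 n (cell a b) (cell a ?x) (cell (Suc ?x) b)"
      using ab Suc.prems by (auto simp: dyadic_split_1_iff)
    note un = dyadic.split_union[OF split]
    have prems1: "1 \<le> a" "a \<le> ?x" "?x \<le> n" "?x - a < 2 ^ L" using Suc.prems ab by auto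
    have prems2: "1 \<le> Suc ?x" "Suc ?x \<le> b" "b \<le> n" "b - Suc ?x < 2 ^ L" using Suc.prems ab by auto
    have c: "card (?T (cell a ?x)) + card (?T (cell (Suc ?x) b)) \<le> card (?T (cell a b)) + 1"
      unfolding un using prems1 by (intro touching_cells_split[OF P]) auto
    have "?T (cell a ?x) \<noteq> {}" "?T (cell (Suc ?x) b) \<noteq> {}"
      using prems1 prems2 by (intro touch; simp add: cell_subset_grid_simps)+
    then have c1: "1 \<le> card (?T (cell a ?x))" "1 \<le> card (?T (cell (Suc ?x) b))"
      using fin by (simp_all add: Suc_le_eq card_gt_0_iff)
    have "j - 1 \<le> L" using Suc.prems by simp
    from Suc.IH[OF prems1 this] obtain Q1 where Q1: "dyadic.tree_part n (cell a ?x) Q1"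
      "\<forall>I\<in>Q1. \<exists>J\<in>P. I \<subseteq> J" "card Q1 \<le> 2 ^ (j - 1) + (card (?T (cell a ?x)) - 1) * (L - (j - 1))"
      by blast
    from Suc.IH[OF prems2 \<open>j - 1 \<le> L\<close>] obtain Q2 where Q2: "dyadic.tree_part n (cell (Suc ?x) b) Q2"
      "\<forall>I\<in>Q2. \<exists>J\<in>P. I \<subseteq> J" "card Q2 \<le> 2 ^ (j - 1) + (card (?T (cell (Suc ?x) b)) - 1) * (L - (j - 1))"
      by blast
    let ?c = "card (?T (cell a b)) - 1"
    have "card (Q1 \<union> Q2) \<le> card Q1 + card Q2" by (rule card_Un_le)
    also have "\<dots> \<le> 2 * 2 ^ (j - 1) +
        ((card (?T (cell a ?x)) - 1) + (card (?T (cell (Suc ?x) b)) - 1)) * (L - (j - 1))"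
      using Q1(3) Q2(3) by (simp add: add_mult_distrib)
    also have "\<dots> \<le> 2 * 2 ^ (j - 1) + ?c * (L - (j - 1))"
      using c c1 by (intro add_left_mono mult_right_mono) auto
    also have "\<dots> \<le> 2 ^ j + ?c * (Suc L - j)"
    \<comment> \<open>For \<open>j = 0\<close> truncated subtraction leaves \<open>2\<close> in
      place of \<open>1\<close> on the left; the surplus is covered by \<open>?c \<ge> 1\<close>, as
      the cell meets at least two pieces. For \<open>j > 0\<close> the two sides agree.\<close>
    proof (cases j)
      case 0
      then show ?thesis using False by simp
    qed simp
    finally have "card (Q1 \<union> Q2) \<le> 2 ^ j + ?c * (Suc L - j)" .
    then show ?thesis
      using dyadic.tree_part.node[OF split Q1(1) Q2(1)] Q1(2) Q2(2)
      by (intro exI[of _ "Q1 \<union> Q2"]) blast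
  qed
qed

lemma ex_dyadic_refinement:
  assumes n: "1 \<le> n" and P: "partition_on (grid 1 n) P" "\<And>J. J \<in> P \<Longrightarrow> is_rectangle 1 n J"
  shows "\<exists>Q. dyadic.tree_part n (grid 1 n) Q \<and> (\<forall>I\<in>Q. \<exists>J\<in>P. I \<subseteq> J) \<and>
    real (card Q) \<le> 3 * real (card P) * ln (exp 1 * real n / real (card P))"
    and "1 \<le> card P" "card P \<le> n"
proof -
  let ?k = "card P"
  have fin: "finite (grid 1 n)" by (simp add: grid_1_simps)
  have finP: "finite P" by (rule finite_elements[OF fin P(1)])
  have "P \<noteq> {}" using P(1) n by (auto simp: partition_on_def grid_1_simps)
  then show k1: "1 \<le> ?k" using finP by (simp add: Suc_le_eq card_gt_0_iff)
  have finJ: "finite J" if "J \<in> P" for J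
    using that P(1) fin by (metis Sup_upper finite_subset partition_onD1)
  have "?k = (\<Sum>J\<in>P. 1)" by simp
  also have "\<dots> \<le> (\<Sum>J\<in>P. card J)"
    using P(1) finJ by (intro sum_mono) (auto simp: partition_on_def Suc_le_eq card_gt_0_iff)
  also have "\<dots> = card (\<Union>P)"
    using P(1) finJ by (intro card_Union_disjoint[symmetric]) (auto simp: partition_on_def)
  also have "\<dots> = card (grid 1 n)" using P(1) by (simp add: partition_on_def)
  also have "\<dots> = n" by (simp add: grid_1_simps card_image inj_on_def)
  finally show kn: "?k \<le> n" .
  \<comment> \<open>The tree is split completely until the number of cells is comparable to the
    number of pieces.\<close>
  obtain j where j: "2 ^ j \<le> ?k" "?k < 2 ^ (j + 1)" using ex_power_ivl1[of 2 ?k] k1 by auto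
  obtain L where L: "2 ^ L \<le> n" "n < 2 ^ (L + 1)" using ex_power_ivl1[of 2 n] n by auto
  have "2 ^ j < (2 :: nat) ^ (L + 1)" using j(1) kn L(2) by linarith
  then have "j < L + 1" by (rule power_less_imp_less_exp[rotated]) simp
  then have jL: "j \<le> L + 1" by simp
  have T: "{J \<in> P. J \<inter> grid 1 n \<noteq> {}} = P"
  proof -
    have "J \<inter> grid 1 n \<noteq> {}" if "J \<in> P" for J
    proof -
      have "J \<noteq> {}" using that partition_onD3[OF P(1)] by metis
      moreover have "J \<subseteq> grid 1 n" using that partition_onD1[OF P(1)] by (simp add: Sup_upper)
      ultimately show ?thesis by (simp add: Int_absorb2)
    qed
    then show ?thesis by blast
  qed
  have "\<exists>Q. dyadic.tree_part n (cell 1 n) Q \<and> (\<forall>I\<in>Q. \<exists>J\<in>P. I \<subseteq> J) \<and>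
      card Q \<le> 2 ^ j + (card {J \<in> P. J \<inter> cell 1 n \<noteq> {}} - 1) * (L + 1 - j)"
    using n L jL by (intro ex_tree_part_refining[OF P]) auto
  then obtain Q where Q: "dyadic.tree_part n (grid 1 n) Q" "\<forall>I\<in>Q. \<exists>J\<in>P. I \<subseteq> J"
    "card Q \<le> 2 ^ j + (?k - 1) * (L + 1 - j)" unfolding grid_1[symmetric] T by blast
  have "card Q \<le> ?k + ?k * (L + 1 - j)"
    using Q(3) j(1) by (meson add_mono diff_le_self le_trans mult_le_mono1)
  then have "real (card Q) \<le> real (?k + ?k * (L + 1 - j))" by (rule of_nat_mono)
  then have "real (card Q) \<le> real ?k * (1 + real (L + 1 - j))"
    by (simp only: of_nat_add of_nat_mult distrib_left mult_1_right)
  \<comment> \<open>The number of remaining levels is at most the binary logarithm of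
    \<open>4 * n / ?k\<close>, that is \<open>2 + ln (n / ?k) / ln 2\<close>. As
    \<open>1 / ln 2 \<le> 3\<close>, adding one gives at most
    \<open>3 * (1 + ln (n / ?k))\<close>.\<close>
  also have "real ?k * (1 + real (L + 1 - j)) \<le> real ?k * (3 * ln (exp 1 * real n / real ?k))"
  proof (rule mult_left_mono)
    have pos: "0 < real n / real ?k" using n k1 by simp
    have "(2 :: real) ^ L \<le> real n" "real ?k \<le> 2 * 2 ^ j"
      using of_nat_mono[OF L(1), where 'a = real] of_nat_mono[OF less_imp_le[OF j(2)], where 'a = real]
      by simp_all
    then have "2 ^ L * real ?k \<le> real n * (2 * 2 ^ j)" by (intro mult_mono) auto
    then have "2 ^ (L + 1) / 2 ^ j \<le> 4 * (real n / real ?k)" using k1 by (simp add: field_simps)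
    moreover have "(2 :: real) ^ (L + 1 - j) = 2 ^ (L + 1) / 2 ^ j"
      using jL by (intro power_diff) auto
    ultimately have le: "2 ^ (L + 1 - j) \<le> 4 * (real n / real ?k)" by simp
    have "real (L + 1 - j) * ln 2 = ln (2 ^ (L + 1 - j))" by (rule ln_realpow[symmetric])
    also have "\<dots> \<le> ln (4 * (real n / real ?k))" using le by (intro ln_mono) auto
    also have "\<dots> = ln (2 ^ 2) + ln (real n / real ?k)"
      using ln_mult_pos[OF _ pos, of 4] by simp
    also have "ln (2 ^ 2 :: real) = 2 * ln 2" by (simp only: ln_realpow of_nat_numeral)
    finally have "real (L + 1 - j) * ln 2 \<le> 2 * ln 2 + ln (real n / real ?k)" .
    moreover have "0 \<le> ln (real n / real ?k)" using kn k1 by simp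
    then have "ln (real n / real ?k) \<le> 3 * ln (real n / real ?k) * ln 2"
      using mult_left_mono[of 1 "3 * ln 2" "ln (real n / real ?k)"] ln2_ge_two_thirds
      by (simp add: algebra_simps)
    ultimately have "real (L + 1 - j) * ln 2 \<le> (2 + 3 * ln (real n / real ?k)) * ln 2"
      by (simp add: algebra_simps)
    then have "real (L + 1 - j) \<le> 2 + 3 * ln (real n / real ?k)"
      using ln2_ge_two_thirds mult_le_cancel_right_pos[of "ln 2"] by simp
    moreover have "ln (exp 1 * real n / real ?k) = 1 + ln (real n / real ?k)"
      using ln_mult_pos[OF exp_gt_zero pos, of 1] by simp
    ultimately show "1 + real (L + 1 - j) \<le> 3 * ln (exp 1 * real n / real ?k)" by simp
  qed simp
  finally show "\<exists>Q. dyadic.tree_part n (grid 1 n) Q \<and> (\<forall>I\<in>Q. \<exists>J\<in>P. I \<subseteq> J) \<and>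
      real (card Q) \<le> 3 * real ?k * ln (exp 1 * real n / real ?k)"
    using Q by (intro exI[of _ Q]) (simp add: mult.assoc)
qed

section \<open>Risk of the dyadic estimator\<close>

lemma sq_dist_eq_ip: "sq_dist I x y = ip I (\<lambda>i. x i - y i) (\<lambda>i. x i - y i)"
  by (simp add: sq_dist_def L2_set_def ip_def sum_nonneg power2_eq_square)

lemma sq_dist_nonneg: "0 \<le> sq_dist I x y"
  by (simp add: sq_dist_def)

lemma sq_dist_commute: "sq_dist I x y = sq_dist I y x"
  by (simp add: sq_dist_def L2_set_def power2_commute)

context local_fit
begin

lemma proj_cong: "(\<And>i. i \<in> I \<Longrightarrow> f i = g i) \<Longrightarrow> proj I f = proj I g"
  by (simp add: fun_eq_iff proj_def ip_cong[of I f g])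

text \<open>The space is an orthogonal sum over the cells, so gluing the cellwise projections solves
  the normal equations. The definite description also demands uniqueness: the difference of two
  solutions is orthogonal to itself, and extensionality fixes the values off
  \<open>G\<close>.\<close>

lemma orth_proj_piecewise:
  assumes G: "finite G" and P: "partition_on G P" and I: "I \<in> P" "i \<in> I"
  shows "orth_proj G {v \<in> G \<rightarrow>\<^sub>E UNIV. \<forall>I\<in>P. v \<in> span_on I b m} y i = proj I y i"
proof -
  let ?S = "{v \<in> G \<rightarrow>\<^sub>E UNIV. \<forall>I\<in>P. v \<in> span_on I b m}"
  define v where "v = (\<lambda>i\<in>G. proj (THE I. I \<in> P \<and> i \<in> I) y i)"
  have sub: "J \<subseteq> G" "finite J" if "J \<in> P" for J
    using that partition_onD1[OF P] finite_subset[OF _ G, of J] by auto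
  have v: "v j = proj J y j" if "J \<in> P" "j \<in> J" for j J
  proof -
    have "(THE I. I \<in> P \<and> j \<in> I) = J"
      using that disjointD[OF partition_onD2[OF P]] by (intro the_equality) auto
    then show ?thesis using sub[OF that(1)] that by (auto simp: v_def)
  qed
  have vS: "v \<in> ?S"
  proof -
    have "v \<in> span_on J b m" if "J \<in> P" for J
      using proj_in_span[OF sub(2)[OF that], of y] v[OF that]
      by (subst span_on_cong[of J v "proj J y"]) auto
    then show ?thesis by (auto simp: v_def)
  qed
  have orth: "(\<Sum>i\<in>G. (y i - v i) * w i) = 0" if "w \<in> ?S" for w
  proof -
    have "(\<Sum>i\<in>G. (y i - v i) * w i) = (\<Sum>J\<in>P. ip J (\<lambda>i. y i - v i) w)"
      using ip_partition[OF G P, of "\<lambda>i. y i - v i" w] by (simp add: ip_def)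
    also have "\<dots> = (\<Sum>J\<in>P. ip J (\<lambda>i. y i - proj J y i) w)"
      using v by (intro sum.cong ip_cong) auto
    also have "\<dots> = 0"
      using that sub residual_orthogonal by (intro sum.neutral) auto
    finally show ?thesis .
  qed
  have uniq: "u = v" if u: "u \<in> ?S" "\<forall>w\<in>?S. (\<Sum>i\<in>G. (y i - u i) * w i) = 0" for u
  proof -
    define w where "w = (\<lambda>i\<in>G. v i - u i)"
    have "w \<in> span_on J b m" if "J \<in> P" for J
    proof -
      have "(\<lambda>i. v i + (- 1) * u i) \<in> span_on J b m"
        using vS u(1) that by (intro span_on_lincomb) auto
      then show ?thesis using sub(1)[OF that]
        by (subst span_on_cong[of J w "\<lambda>i. v i + (- 1) * u i"]) (auto simp: w_def)
    qed
    then have "w \<in> ?S" by (auto simp: w_def)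
    then have "(\<Sum>i\<in>G. (y i - u i) * w i) - (\<Sum>i\<in>G. (y i - v i) * w i) = 0"
      using u(2) orth by simp
    then have "ip G w w = 0"
      by (simp add: sum_subtractf[symmetric] left_diff_distrib[symmetric] ip_def w_def)
    from ip_self_eq_0[OF G this] have "\<And>i. i \<in> G \<Longrightarrow> v i = u i" by (auto simp: w_def)
    then show ?thesis using vS u(1) by (intro PiE_ext[of _ G "\<lambda>_. UNIV"]) auto
  qed
  have "orth_proj G ?S y = v"
    unfolding orth_proj_def
  proof (rule the_equality)
    show "v \<in> ?S \<and> (\<forall>w\<in>?S. (\<Sum>i\<in>G. (y i - v i) * w i) = 0)"
      by (intro conjI ballI vS orth)
  qed (elim conjE, rule uniq)
  then show ?thesis using v[OF I] by simp
qed

end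

section \<open>Piecewise polynomials in one variable and their number of pieces\<close>

definition monomial :: "nat \<Rightarrow> nat \<Rightarrow> nat list \<Rightarrow> real" where
  "monomial n j i = (real (hd i) / real n) ^ j"

lemma poly_eval_1: "poly_eval 1 q c [x] = (\<Sum>j<Suc q. c [j] * x ^ j)"
proof -
  have "{\<alpha> :: nat list. length \<alpha> = 1 \<and> sum_list \<alpha> \<le> q} = (\<lambda>j. [j]) ` {..q}"
    by (auto simp: length_Suc_conv)
  then show ?thesis
    by (simp add: poly_eval_def sum.reindex inj_on_def lessThan_Suc_atMost)
qed

lemma pp_space_eq:
  assumes P: "\<And>I. I \<in> P \<Longrightarrow> I \<subseteq> grid 1 n"
  shows "pp_space r 1 n P = {v \<in> grid 1 n \<rightarrow>\<^sub>E UNIV. \<forall>I\<in>P. v \<in> span_on I (monomial n) (Suc r)}"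
proof -
  have "(\<exists>c. \<forall>i\<in>I. v i = poly_eval 1 r c (map (\<lambda>m. real m / real n) i)) \<longleftrightarrow>
      v \<in> span_on I (monomial n) (Suc r)" if "I \<in> P" for I v
  proof -
    have eval: "poly_eval 1 r c (map (\<lambda>m. real m / real n) i)
        = (\<Sum>j<Suc r. c [j] * monomial n j i)" if "i \<in> I" for c i
    proof -
      obtain k where "i = [k]" using P[OF \<open>I \<in> P\<close>] \<open>i \<in> I\<close> by (auto simp: grid_1_simps)
      then show ?thesis using poly_eval_1[of r c "real k / real n"] by (simp add: monomial_def)
    qed
    show ?thesis
    proof
      assume "\<exists>c. \<forall>i\<in>I. v i = poly_eval 1 r c (map (\<lambda>m. real m / real n) i)"
      then obtain c where "\<forall>i\<in>I. v i = poly_eval 1 r c (map (\<lambda>m. real m / real n) i)" by blast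
      then show "v \<in> span_on I (monomial n) (Suc r)"
        using eval[of _ c] by (intro span_onI[where c = "\<lambda>j. c [j]"]) simp
    next
      assume "v \<in> span_on I (monomial n) (Suc r)"
      then obtain c where "\<forall>i\<in>I. v i = (\<Sum>j<Suc r. c j * monomial n j i)"
        by (auto simp: span_on_def)
      then show "\<exists>c. \<forall>i\<in>I. v i = poly_eval 1 r c (map (\<lambda>m. real m / real n) i)"
        using eval[of _ "\<lambda>\<alpha>. c (hd \<alpha>)"] by (intro exI[of _ "\<lambda>\<alpha>. c (hd \<alpha>)"]) simp
    qed
  qed
  then show ?thesis by (auto simp: pp_space_def arrays_def)
qed

lemma span_on_monomial_singleton: "v \<in> span_on {i} (monomial n) (Suc r)"
  by (rule span_onI[where c = "\<lambda>j. if j = 0 then v i else 0"])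
    (simp add: sum.lessThan_Suc_shift monomial_def del: sum.lessThan_Suc)

text \<open>The partition into single points fits every array, so the minimum in
  \<open>num_pieces\<close> is taken over a nonempty finite set and is attained.\<close>

lemma num_pieces_All_attained:
  assumes "\<theta> \<in> arrays 1 n"
  obtains P where "partition_on (grid 1 n) P" "\<And>J. J \<in> P \<Longrightarrow> is_rectangle 1 n J"
    "\<theta> \<in> pp_space r 1 n P" "card P = num_pieces All r 1 n \<theta>"
proof -
  let ?A = "{P \<in> partitions All 1 n. \<theta> \<in> pp_space r 1 n P}"
  have "partitions All 1 n \<subseteq> Pow (Pow (grid 1 n))" by (auto simp: is_rectangle_def)
  then have "finite (partitions All 1 n)" by (rule finite_subset) (simp add: grid_1_simps)
  then have fin: "finite (card ` ?A)" by (intro finite_imageI) (rule finite_subset[rotated], auto)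
  let ?P = "(\<lambda>x. {x}) ` grid 1 n"
  have "partition_on (grid 1 n) ?P" by (auto simp: partition_on_def disjoint_def)
  moreover have "is_rectangle 1 n {x}" if "x \<in> grid 1 n" for x
  proof -
    obtain k where k: "x = [k]" using \<open>x \<in> grid 1 n\<close> by (auto simp: grid_1_simps)
    then have "{x} = grid_box [k] [k]" by (simp add: grid_box_1)
    then show ?thesis using that unfolding is_rectangle_def by blast
  qed
  moreover have "\<theta> \<in> pp_space r 1 n ?P"
    using assms by (subst pp_space_eq) (auto simp: arrays_def span_on_monomial_singleton)
  ultimately have "?P \<in> ?A" by auto
  then have "card ` ?A \<noteq> {}" by blast
  from Min_in[OF fin this] obtain P where P: "P \<in> ?A" "card P = num_pieces All r 1 n \<theta>"
    unfolding num_pieces_def by (metis (no_types, lifting) imageE)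
  with that[of P] show thesis by auto
qed

lemma pp_space_refine:
  assumes "\<theta> \<in> pp_space r d n P" "\<forall>I\<in>Q. \<exists>J\<in>P. I \<subseteq> J"
  shows "\<theta> \<in> pp_space r d n Q"
proof -
  have "\<exists>c. \<forall>i\<in>I. \<theta> i = poly_eval d r c (map (\<lambda>m. real m / real n) i)" if "I \<in> Q" for I
  proof -
    obtain J where J: "J \<in> P" "I \<subseteq> J" using assms(2) \<open>I \<in> Q\<close> by blast
    then have "\<exists>c. \<forall>i\<in>J. \<theta> i = poly_eval d r c (map (\<lambda>m. real m / real n) i)"
      using assms(1) by (simp add: pp_space_def)
    then obtain c where "\<forall>i\<in>J. \<theta> i = poly_eval d r c (map (\<lambda>m. real m / real n) i)" ..
    then show ?thesis using J(2) by (intro exI[of _ c]) auto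
  qed
  then show ?thesis using assms(1) by (simp add: pp_space_def)
qed

text \<open>The bound \<open>A\<close> depends on \<open>C\<close> and \<open>m\<close> only. From
  \<open>n0\<close> on, the logarithm makes the penalty strong enough for
  \<open>sum_tree_parts_le\<close>; below \<open>n0\<close>, finitely many grids are handled by the
  crude count.\<close>

lemma tree_weight_bounded:
  fixes C :: real and m :: nat
  assumes C: "0 < C" and m: "0 < m"
  shows "\<exists>A\<ge>0. \<forall>n \<sigma> lam J. 1 \<le> n \<longrightarrow> 0 < \<sigma> \<longrightarrow> C * \<sigma>\<^sup>2 * ln (real n) \<le> lam \<longrightarrow> J \<subseteq> grid 1 n \<longrightarrow>
    (\<Sum>Q | dyadic.tree_part n J Q. (sqrt 2 * exp (- lam / (32 * real m * \<sigma>\<^sup>2))) ^ card Q) \<le> A"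
proof -
  \<comment> \<open>Here 160 is \<open>32 * 5\<close>: the exponent reaches 5, the exponential is
    then at least 6, and \<open>3 / 2 * (1 / 6)\<close> is the admissible weight
    \<open>1 / 4\<close>.\<close>
  obtain n0 :: nat where n0: "exp (160 * real m / C) \<le> real n0" using real_arch_simple by blast
  let ?A = "2 ^ 2 ^ n0 * 2 ^ n0 :: real"
  have sqrt2: "sqrt 2 \<le> 3 / 2" by (rule real_le_lsqrt) (auto simp: power2_eq_square)
  have "(\<Sum>Q | dyadic.tree_part n J Q. (sqrt 2 * exp (- lam / (32 * real m * \<sigma>\<^sup>2))) ^ card Q) \<le> ?A"
    if n: "1 \<le> n" and \<sigma>: "0 < \<sigma>" and lam: "C * \<sigma>\<^sup>2 * ln (real n) \<le> lam" and J: "J \<subseteq> grid 1 n"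
    for n \<sigma> lam J
  proof -
    let ?x = "sqrt 2 * exp (- lam / (32 * real m * \<sigma>\<^sup>2))"
    have fin: "finite J" using J by (rule finite_subset) (simp add: grid_1_simps)
    show ?thesis
    proof (cases "n0 \<le> n")
      case True
      then have "exp (160 * real m / C) \<le> real n" using n0 by linarith
      then have "160 * real m / C \<le> ln (real n)" using n by (simp add: ln_ge_iff)
      then have "160 * real m * \<sigma>\<^sup>2 \<le> C * ln (real n) * \<sigma>\<^sup>2"
        using C by (intro mult_right_mono) (auto simp: field_simps)
      then have "160 * real m * \<sigma>\<^sup>2 \<le> lam" using lam by (simp add: algebra_simps)
      then have "5 \<le> lam / (32 * real m * \<sigma>\<^sup>2)" using m \<sigma> by (simp add: field_simps)
      then have "6 \<le> exp (lam / (32 * real m * \<sigma>\<^sup>2))"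
        using exp_ge_add_one_self[of "lam / (32 * real m * \<sigma>\<^sup>2)"] by linarith
      then have "exp (- lam / (32 * real m * \<sigma>\<^sup>2)) \<le> 1 / 6"
        by (simp add: exp_minus field_simps)
      then have "?x \<le> 3 / 2 * (1 / 6)" using sqrt2 by (intro mult_mono) auto
      then have x: "?x \<le> 1 / 4" by simp
      have "(\<Sum>Q | dyadic.tree_part n J Q. ?x ^ card Q) \<le> 2 * ?x"
        by (rule dyadic.sum_tree_parts_le[OF fin _ x]) simp
      also have "\<dots> \<le> 1 * 1" using x by simp
      also have "\<dots> \<le> ?A" by (intro mult_mono) auto
      finally show ?thesis .
    next
      case False
      have "0 \<le> C * \<sigma>\<^sup>2 * ln (real n)" using C n by simp
      then have "0 \<le> lam / (32 * real m * \<sigma>\<^sup>2)" using lam by simp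
      then have "?x \<le> 3 / 2 * 1" using sqrt2 by (intro mult_mono) auto
      moreover have "card J \<le> card (grid 1 n)" using J by (intro card_mono) (simp_all add: grid_1_simps)
      then have "card J \<le> n0" using False by (simp add: grid_1_simps card_image inj_on_def)
      ultimately show ?thesis by (intro dyadic.sum_tree_parts_le_crude[OF fin]) auto
    qed
  qed
  then show ?thesis by (intro exI[of _ ?A]) auto
qed

text \<open>Over tree partitions the objective is \<open>cost\<close> and the squared error is
  \<open>loss\<close>, so the selected partition is a minimizer to which the integrable majorant
  applies. The bias of \<open>P\<close> is at most the distance to \<open>\<theta>\<close> because
  \<open>rss\<close> is the least squared distance on each cell.\<close>

lemma risk_le_tree_part:
  assumes n: "1 \<le> n" and \<sigma>: "0 < \<sigma>" and lam: "0 \<le> lam"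
    and P: "dyadic.tree_part n (grid 1 n) P" and \<theta>: "\<theta> \<in> pp_space r 1 n P"
    and A: "\<And>J. J \<subseteq> grid 1 n \<Longrightarrow> (\<Sum>Q | dyadic.tree_part n J Q.
      (sqrt 2 * exp (- lam / (32 * real (Suc r) * \<sigma>\<^sup>2))) ^ card Q) \<le> A"
  shows "risk RDP r lam 1 n \<sigma> \<theta>s
    \<le> sq_dist (grid 1 n) \<theta> \<theta>s + (4 * lam + 16 * real (Suc r) * \<sigma>\<^sup>2 * A) * real (card P)"
proof -
  interpret tree_fit "dyadic_split_1 n" "monomial n" "Suc r"
    by (rule tree_fit.intro[OF dyadic.binary_splitting_axioms])
  let ?G = "grid 1 n"
  have G: "finite ?G" by (simp add: grid_1_simps)
  have space: "pp_space r 1 n Q = {v \<in> ?G \<rightarrow>\<^sub>E UNIV. \<forall>I\<in>Q. v \<in> span_on I (monomial n) (Suc r)}"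
    if "dyadic.tree_part n ?G Q" for Q
    using dyadic.tree_part_subset[OF that] by (rule pp_space_eq)
  have cells: "finite I" "I \<subseteq> ?G" if "dyadic.tree_part n ?G Q" "I \<in> Q" for I Q
    using dyadic.tree_part_subset[OF that] finite_subset[OF _ G] by auto
  obtain g where g: "integrable (std_gaussian ?G) g"
    "(LINT z|std_gaussian ?G. g z)
      \<le> (\<Sum>I\<in>P. rss I \<theta>s) + (4 * lam + 16 * real (Suc r) * \<sigma>\<^sup>2 * A) * real (card P)"
    "\<And>z P'. \<lbrakk>dyadic.tree_part n ?G P'; \<forall>Q. dyadic.tree_part n ?G Q \<longrightarrow>
        cost (\<lambda>i. \<theta>s i + \<sigma> * z i) lam P' \<le> cost (\<lambda>i. \<theta>s i + \<sigma> * z i) lam Q\<rbrakk> \<Longrightarrow>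
      loss \<theta>s (\<lambda>i. \<sigma> * z i) P' \<le> g z"
    using ex_integrable_loss_bound[OF G P zero_less_Suc \<sigma> lam A, of \<theta>s] by blast
  let ?f = "\<lambda>z. sq_dist ?G (estimator RDP r lam 1 n (\<lambda>i\<in>?G. \<theta>s i + \<sigma> * z i)) \<theta>s"
  have le: "?f z \<le> g z" for z
  proof -
    let ?y = "\<lambda>i\<in>?G. \<theta>s i + \<sigma> * z i" and ?y' = "\<lambda>i. \<theta>s i + \<sigma> * z i"
    have proj: "orth_proj ?G (pp_space r 1 n Q) ?y i = proj I ?y' i"
      if "dyadic.tree_part n ?G Q" "I \<in> Q" "i \<in> I" for Q I i
      unfolding space[OF that(1)]
        orth_proj_piecewise[OF G dyadic.tree_part_partition_on[OF that(1)] that(2,3)]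
      using cells[OF that(1,2)] by (subst proj_cong[of I ?y ?y']) auto
    have obj: "objective r lam 1 n ?y Q = cost ?y' lam Q" if Q: "dyadic.tree_part n ?G Q" for Q
    proof -
      have "sq_dist ?G ?y (orth_proj ?G (pp_space r 1 n Q) ?y)
          = (\<Sum>I\<in>Q. ip I (\<lambda>i. ?y i - orth_proj ?G (pp_space r 1 n Q) ?y i)
              (\<lambda>i. ?y i - orth_proj ?G (pp_space r 1 n Q) ?y i))"
        unfolding sq_dist_eq_ip by (rule ip_partition[OF G dyadic.tree_part_partition_on[OF Q]])
      also have "\<dots> = (\<Sum>I\<in>Q. ip I (\<lambda>i. ?y' i - proj I ?y' i) (\<lambda>i. ?y' i - proj I ?y' i))"
        using proj[OF Q] cells[OF Q] by (intro sum.cong ip_cong) (auto simp: subset_iff)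
      also have "\<dots> = (\<Sum>I\<in>Q. rss I ?y')"
        using cells[OF Q] by (intro sum.cong sq_residual_proj) auto
      finally show ?thesis by (simp add: objective_def cost_def sum.distrib)
    qed
    define P' where "P' = arg_min_on (objective r lam 1 n ?y) (partitions RDP 1 n)"
    have parts: "partitions RDP 1 n = {Q. dyadic.tree_part n ?G Q}"
      using split_partitions_tree_part[OF n] by simp
    have "finite (partitions RDP 1 n)" "partitions RDP 1 n \<noteq> {}"
      unfolding parts using dyadic.finite_tree_parts[OF G] P by auto
    note argmin = arg_min_if_finite[OF this, of "objective r lam 1 n ?y", folded P'_def]
    have P': "dyadic.tree_part n ?G P'" using argmin(1) parts by simp
    have "cost ?y' lam P' \<le> cost ?y' lam Q" if "dyadic.tree_part n ?G Q" for Q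
      using argmin(2) that parts obj[OF that] obj[OF P'] by (metis mem_Collect_eq not_le)
    then have "loss \<theta>s (\<lambda>i. \<sigma> * z i) P' \<le> g z" using g(3)[OF P'] by blast
    moreover have "?f z = loss \<theta>s (\<lambda>i. \<sigma> * z i) P'"
    proof -
      have "?f z = sq_dist ?G (orth_proj ?G (pp_space r 1 n P') ?y) \<theta>s"
        by (simp add: estimator_def P'_def)
      also have "\<dots> = (\<Sum>I\<in>P'. ip I (\<lambda>i. orth_proj ?G (pp_space r 1 n P') ?y i - \<theta>s i)
              (\<lambda>i. orth_proj ?G (pp_space r 1 n P') ?y i - \<theta>s i))"
        unfolding sq_dist_eq_ip by (rule ip_partition[OF G dyadic.tree_part_partition_on[OF P']])
      also have "\<dots> = (\<Sum>I\<in>P'. ip I (\<lambda>i. proj I ?y' i - \<theta>s i) (\<lambda>i. proj I ?y' i - \<theta>s i))"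
        using proj[OF P'] by (intro sum.cong ip_cong) auto
      also have "\<dots> = loss \<theta>s (\<lambda>i. \<sigma> * z i) P'"
        unfolding loss_def using cells[OF P'] by (intro sum.cong loss_eq) auto
      finally show ?thesis .
    qed
    ultimately show ?thesis by simp
  qed
  have "(\<Sum>I\<in>P. rss I \<theta>s) \<le> (\<Sum>I\<in>P. ip I (\<lambda>i. \<theta>s i - \<theta> i) (\<lambda>i. \<theta>s i - \<theta> i))"
    using \<theta>[unfolded space[OF P]] cells[OF P] by (intro sum_mono rss_le) auto
  also have "\<dots> = sq_dist ?G \<theta>s \<theta>"
    unfolding sq_dist_eq_ip by (rule ip_partition[OF G dyadic.tree_part_partition_on[OF P], symmetric])
  also have "\<dots> = sq_dist ?G \<theta> \<theta>s" by (rule sq_dist_commute)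
  finally have bias: "(\<Sum>I\<in>P. rss I \<theta>s) \<le> sq_dist ?G \<theta> \<theta>s" .
  have "risk RDP r lam 1 n \<sigma> \<theta>s = (LINT z|std_gaussian ?G. ?f z)" by (simp add: risk_def)
  also have "\<dots> \<le> (LINT z|std_gaussian ?G. g z)"
  proof (cases "integrable (std_gaussian ?G) ?f")
    case True
    then show ?thesis using g(1) le by (intro integral_mono)
  next
    \<comment> \<open>The integral of a non-integrable function is zero by convention, and
      \<open>g\<close> is nonnegative.\<close>
    case False
    have "0 \<le> g z" for z using order_trans[OF sq_dist_nonneg le] .
    then show ?thesis using False by (simp add: not_integrable_integral_eq)
  qed
  also note g(2)
  finally show ?thesis using bias by linarith
qed

lemma ln_ratio_ge_1:
  assumes "1 \<le> k" "k \<le> n"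
  shows "1 \<le> ln (exp 1 * real n / real k)"
proof -
  have "exp 1 * 1 \<le> exp 1 * (real n / real k)" using assms by (intro mult_left_mono) auto
  then have "ln (exp 1) \<le> ln (exp 1 * real n / real k)" by (intro ln_mono) auto
  then show ?thesis by simp
qed

text \<open>For \<open>n \<ge> 2\<close> the logarithm is at least 1/2, so
  \<open>\<sigma>\<^sup>2 \<le> 2 * lam / C\<close> and the whole noise term is absorbed into the
  penalty. The constant is free of \<open>\<delta>\<close>, and no remainder is left.\<close>

lemma risk_sharp_bound:
  assumes C: "0 < C"
  shows "\<exists>K\<ge>1. \<forall>\<sigma> n lam \<theta> \<theta>s. 0 < \<sigma> \<longrightarrow> 2 \<le> n \<longrightarrow> C * \<sigma>\<^sup>2 * ln (real n) \<le> lam \<longrightarrow> \<theta> \<in> arrays 1 n \<longrightarrow>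
    risk RDP r lam 1 n \<sigma> \<theta>s \<le> sq_dist (grid 1 n) \<theta> \<theta>s
      + lam * K * real (num_pieces All r 1 n \<theta>)
        * ln (exp 1 * real n / real (num_pieces All r 1 n \<theta>))"
proof -
  obtain A where A: "0 \<le> A" "\<And>n \<sigma> lam J. \<lbrakk>1 \<le> n; 0 < \<sigma>; C * \<sigma>\<^sup>2 * ln (real n) \<le> lam; J \<subseteq> grid 1 n\<rbrakk> \<Longrightarrow>
    (\<Sum>Q | dyadic.tree_part n J Q. (sqrt 2 * exp (- lam / (32 * real (Suc r) * \<sigma>\<^sup>2))) ^ card Q) \<le> A"
    using tree_weight_bounded[OF C, of "Suc r"] by blast
  define M where "M = 16 * real (Suc r) * A"
  have M0: "0 \<le> M" using A(1) by (simp add: M_def)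
  let ?K = "3 * (4 + 2 * M / C)"
  have "risk RDP r lam 1 n \<sigma> \<theta>s \<le> sq_dist (grid 1 n) \<theta> \<theta>s
      + lam * ?K * real (num_pieces All r 1 n \<theta>)
        * ln (exp 1 * real n / real (num_pieces All r 1 n \<theta>))"
    if \<sigma>: "0 < \<sigma>" and n: "2 \<le> n" and lam: "C * \<sigma>\<^sup>2 * ln (real n) \<le> lam" and \<theta>: "\<theta> \<in> arrays 1 n"
    for \<sigma> n lam \<theta> \<theta>s
  proof -
    obtain P where P: "partition_on (grid 1 n) P" "\<And>J. J \<in> P \<Longrightarrow> is_rectangle 1 n J"
      "\<theta> \<in> pp_space r 1 n P" "card P = num_pieces All r 1 n \<theta>"
      using num_pieces_All_attained[OF \<theta>] by metis
    have n1: "1 \<le> n" using n by simp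
    obtain Q where Q: "dyadic.tree_part n (grid 1 n) Q" "\<forall>I\<in>Q. \<exists>J\<in>P. I \<subseteq> J"
      "real (card Q) \<le> 3 * real (card P) * ln (exp 1 * real n / real (card P))"
      using ex_dyadic_refinement(1)[OF n1 P(1,2)] by blast
    have "ln 2 \<le> ln (real n)" using n by (intro ln_mono) auto
    then have "1 / 2 \<le> ln (real n)" using ln2_ge_two_thirds by linarith
    then have "C * \<sigma>\<^sup>2 * (1 / 2) \<le> C * \<sigma>\<^sup>2 * ln (real n)" using C by (intro mult_left_mono) auto
    then have "C * \<sigma>\<^sup>2 \<le> 2 * lam" using lam by linarith
    then have \<sigma>2: "\<sigma>\<^sup>2 \<le> 2 * lam / C" using C by (simp add: pos_le_divide_eq mult.commute)
    have lam0: "0 \<le> lam" using order_trans[OF _ lam] C n by simp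
    have "16 * real (Suc r) * \<sigma>\<^sup>2 * A = M * \<sigma>\<^sup>2" by (simp add: M_def)
    also have "\<dots> \<le> M * (2 * lam / C)" using \<sigma>2 M0 by (intro mult_left_mono) auto
    finally have coeff: "4 * lam + 16 * real (Suc r) * \<sigma>\<^sup>2 * A \<le> lam * (4 + 2 * M / C)"
      by (simp add: algebra_simps)
    have "risk RDP r lam 1 n \<sigma> \<theta>s
        \<le> sq_dist (grid 1 n) \<theta> \<theta>s + (4 * lam + 16 * real (Suc r) * \<sigma>\<^sup>2 * A) * real (card Q)"
      by (rule risk_le_tree_part[OF n1 \<sigma> lam0 Q(1) pp_space_refine[OF P(3) Q(2)] A(2)[OF n1 \<sigma> lam]])
    also have "(4 * lam + 16 * real (Suc r) * \<sigma>\<^sup>2 * A) * real (card Q)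
        \<le> lam * (4 + 2 * M / C) * (3 * real (card P) * ln (exp 1 * real n / real (card P)))"
      using coeff Q(3) lam0 M0 C by (intro mult_mono) auto
    finally show ?thesis unfolding P(4) by (simp add: algebra_simps)
  qed
  moreover have "1 \<le> ?K" using M0 C by simp
  ultimately show ?thesis by blast
qed

lemma num_pieces_RDP_single:
  assumes "\<theta> \<in> arrays 1 1" shows "num_pieces RDP r 1 1 \<theta> \<le> 1"
proof -
  let ?A = "{P \<in> partitions RDP 1 1. \<theta> \<in> pp_space r 1 1 P}"
  have "partitions RDP 1 1 = {P. dyadic.tree_part 1 (grid 1 1) P}"
    using split_partitions_tree_part[of 1] by simp
  then have "finite (partitions RDP 1 1)"
    using dyadic.finite_tree_parts[of "grid 1 1" 1] by (simp add: grid_1_simps)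
  then have "finite (card ` ?A)" by (intro finite_imageI) (rule finite_subset[rotated], auto)
  moreover have "grid 1 1 = {[1]}" by (simp add: grid_1_simps)
  then have "\<theta> \<in> pp_space r 1 1 {grid 1 1}"
    using assms by (subst pp_space_eq) (auto simp: arrays_def span_on_monomial_singleton)
  then have "{grid 1 1} \<in> ?A" by (simp add: split_partitions.start)
  then have "card {grid 1 1} \<in> card ` ?A" by (rule imageI)
  ultimately show ?thesis unfolding num_pieces_def using Min_le by fastforce
qed

theorem theorem5p2:
  fixes r :: nat and C :: real
  assumes "1 \<le> r" and "0 < C" and "oracle_inequality C r"
  shows "\<exists>Cr>0. \<forall>\<delta> \<sigma> n. \<forall>\<theta>s \<in> arrays 1 n.
    0 < \<delta> \<and> \<delta> < 1 \<and> 0 < \<sigma> \<and> 1 \<le> n \<longrightarrow>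
      (\<forall>lam \<ge> C * \<sigma>\<^sup>2 * ln (real n).
        risk RDP r lam 1 n \<sigma> \<theta>s
          \<le> (INF \<theta> \<in> arrays 1 n. (1 + \<delta>) / (1 - \<delta>) * sq_dist (grid 1 n) \<theta> \<theta>s
                + lam * Cr / (1 - \<delta>) * real (num_pieces All r 1 n \<theta>)
                    * ln (exp 1 * real n / real (num_pieces All r 1 n \<theta>)))
            + C * (\<sigma>\<^sup>2 / (\<delta> * (1 - \<delta>)))) \<and>
      (2 \<le> n \<longrightarrow>
        MSE RDP r (C * \<sigma>\<^sup>2 * ln (real n)) 1 n \<sigma> \<theta>s
          \<le> Cr * \<sigma>\<^sup>2 * (real (num_pieces All r 1 n \<theta>s) * ln (real n)
               * ln (exp 1 * real n / real (num_pieces All r 1 n \<theta>s)) / real n))"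
proof -
  obtain K where K: "1 \<le> K" and sharp: "\<And>\<sigma> n lam \<theta> \<theta>s. \<lbrakk>0 < \<sigma>; 2 \<le> n; C * \<sigma>\<^sup>2 * ln (real n) \<le> lam;
      \<theta> \<in> arrays 1 n\<rbrakk> \<Longrightarrow> risk RDP r lam 1 n \<sigma> \<theta>s \<le> sq_dist (grid 1 n) \<theta> \<theta>s
      + lam * K * real (num_pieces All r 1 n \<theta>)
        * ln (exp 1 * real n / real (num_pieces All r 1 n \<theta>))"
    using risk_sharp_bound[OF assms(2), of r] by blast
  \<comment> \<open>The oracle inequality asks for \<open>K\<close>; the bound on the mean squared
    error asks for \<open>C * K\<close>, since its penalty is
    \<open>C * \<sigma>\<^sup>2 * ln n\<close>.\<close>
  define Cr where "Cr = max K (C * K)"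
  have Cr: "K \<le> Cr" "C * K \<le> Cr" "1 \<le> Cr" "0 < Cr" using K by (auto simp: Cr_def)
  let ?k = "\<lambda>n \<theta>. real (num_pieces All r 1 n \<theta>)"
  let ?l = "\<lambda>n \<theta>. ln (exp 1 * real n / ?k n \<theta>)"
  have k: "1 \<le> num_pieces All r 1 n \<theta>" "num_pieces All r 1 n \<theta> \<le> n"
    if n: "1 \<le> n" and \<theta>: "\<theta> \<in> arrays 1 n" for n \<theta>
  proof -
    obtain P where "partition_on (grid 1 n) P" "\<And>J. J \<in> P \<Longrightarrow> is_rectangle 1 n J"
      "card P = num_pieces All r 1 n \<theta>"
      using num_pieces_All_attained[OF \<theta>] by metis
    then show "1 \<le> num_pieces All r 1 n \<theta>" "num_pieces All r 1 n \<theta> \<le> n"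
      using ex_dyadic_refinement(2,3)[OF n] by metis+
  qed
  have l: "1 \<le> ?l n \<theta>" if "1 \<le> n" "\<theta> \<in> arrays 1 n" for n \<theta>
    using k[OF that] by (rule ln_ratio_ge_1)
  have ne: "arrays 1 n \<noteq> {}" for n by (simp add: arrays_def PiE_eq_empty_iff)
  have bound: "risk RDP r lam 1 n \<sigma> \<theta>s
      \<le> (INF \<theta> \<in> arrays 1 n. (1 + \<delta>) / (1 - \<delta>) * sq_dist (grid 1 n) \<theta> \<theta>s
            + lam * Cr / (1 - \<delta>) * ?k n \<theta> * ?l n \<theta>) + C * (\<sigma>\<^sup>2 / (\<delta> * (1 - \<delta>)))"
    if \<theta>s: "\<theta>s \<in> arrays 1 n" and \<delta>: "0 < \<delta>" "\<delta> < 1" and \<sigma>: "0 < \<sigma>" and n: "1 \<le> n"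
      and lam: "C * \<sigma>\<^sup>2 * ln (real n) \<le> lam" for \<delta> \<sigma> n \<theta>s lam
  proof -
    have lam0: "0 \<le> lam" using order_trans[OF _ lam] assms(2) n by simp
    have kl: "0 \<le> ?k n \<theta> * ?l n \<theta>" if "\<theta> \<in> arrays 1 n" for \<theta>
      using l[OF n that] by simp
    show ?thesis
    proof (cases "2 \<le> n")
      case True
      have rem: "0 \<le> C * (\<sigma>\<^sup>2 / (\<delta> * (1 - \<delta>)))" using \<delta> assms(2) by simp
      have "risk RDP r lam 1 n \<sigma> \<theta>s \<le> (1 + \<delta>) / (1 - \<delta>) * sq_dist (grid 1 n) \<theta> \<theta>s
            + lam * Cr / (1 - \<delta>) * ?k n \<theta> * ?l n \<theta>" if \<theta>: "\<theta> \<in> arrays 1 n" for \<theta>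
      proof -
        have "1 * sq_dist (grid 1 n) \<theta> \<theta>s \<le> (1 + \<delta>) / (1 - \<delta>) * sq_dist (grid 1 n) \<theta> \<theta>s"
          using \<delta> by (intro mult_right_mono) (auto simp: sq_dist_nonneg)
        moreover have "lam * K * (?k n \<theta> * ?l n \<theta>) \<le> lam * Cr / (1 - \<delta>) * (?k n \<theta> * ?l n \<theta>)"
        proof (rule mult_right_mono[OF _ kl[OF \<theta>]])
          have "lam * K \<le> lam * Cr" using lam0 Cr by (intro mult_left_mono) auto
          also have "\<dots> \<le> lam * Cr / (1 - \<delta>)"
            using \<delta> lam0 Cr by (simp add: pos_le_divide_eq mult_left_le)
          finally show "lam * K \<le> lam * Cr / (1 - \<delta>)" .
        qed
        ultimately show ?thesis using sharp[OF \<sigma> True lam \<theta>, of \<theta>s] by (simp only: mult.assoc)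
      qed
      then have "risk RDP r lam 1 n \<sigma> \<theta>s \<le> (INF \<theta> \<in> arrays 1 n.
          (1 + \<delta>) / (1 - \<delta>) * sq_dist (grid 1 n) \<theta> \<theta>s + lam * Cr / (1 - \<delta>) * ?k n \<theta> * ?l n \<theta>)"
        by (rule cINF_greatest[OF ne])
      then show ?thesis using rem by linarith
    next
      case False
      then have n1: "n = 1" using n by simp
      let ?b = "\<lambda>\<theta>. (1 + \<delta>) / (1 - \<delta>) * sq_dist (grid 1 n) \<theta> \<theta>s
          + lam / (1 - \<delta>) * real (num_pieces RDP r 1 n \<theta>)"
      \<comment> \<open>As \<open>ln 1 = 0\<close>, the threshold of the assumed inequality is zero
        and every nonnegative \<open>lam\<close> passes it.\<close>
      have "C * real ((r + 1 - 1) choose (1 - 1)) * \<sigma>\<^sup>2 * ln (real (n ^ 1)) / \<delta> \<le> lam"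
        using lam0 n1 by simp
      then have "risk RDP r lam 1 n \<sigma> \<theta>s \<le> (INF \<theta> \<in> arrays 1 n. ?b \<theta>) + C * (\<sigma>\<^sup>2 / (\<delta> * (1 - \<delta>)))"
        using assms(3)[unfolded oracle_inequality_def, rule_format, of \<theta>s 1 n \<delta> \<sigma> lam RDP] \<theta>s \<delta> \<sigma> n
        by blast
      also have "(INF \<theta> \<in> arrays 1 n. ?b \<theta>) \<le> (INF \<theta> \<in> arrays 1 n.
          (1 + \<delta>) / (1 - \<delta>) * sq_dist (grid 1 n) \<theta> \<theta>s + lam * Cr / (1 - \<delta>) * ?k n \<theta> * ?l n \<theta>)"
      proof (rule cINF_mono[OF ne])
        show "bdd_below (?b ` arrays 1 n)"
          using \<delta> lam0 by (intro bdd_belowI2[of _ 0]) (simp add: sq_dist_nonneg)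
        fix \<theta> assume \<theta>: "\<theta> \<in> arrays 1 n"
        have "real (num_pieces RDP r 1 n \<theta>) \<le> 1"
          using num_pieces_RDP_single[of \<theta> r] \<theta> n1 by simp
        also have "1 \<le> Cr * (?k n \<theta> * ?l n \<theta>)"
          using mult_mono[OF Cr(3) mult_mono[OF _ l[OF n \<theta>], of 1 "?k n \<theta>"]] k(1)[OF n \<theta>] Cr by simp
        finally have "lam / (1 - \<delta>) * real (num_pieces RDP r 1 n \<theta>)
            \<le> lam / (1 - \<delta>) * (Cr * (?k n \<theta> * ?l n \<theta>))"
          using lam0 \<delta> by (intro mult_left_mono) auto
        then have "?b \<theta> \<le> (1 + \<delta>) / (1 - \<delta>) * sq_dist (grid 1 n) \<theta> \<theta>s
            + lam * Cr / (1 - \<delta>) * ?k n \<theta> * ?l n \<theta>" by (simp add: mult.assoc)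
        then show "\<exists>\<theta>'\<in>arrays 1 n. ?b \<theta>' \<le> (1 + \<delta>) / (1 - \<delta>) * sq_dist (grid 1 n) \<theta> \<theta>s
            + lam * Cr / (1 - \<delta>) * ?k n \<theta> * ?l n \<theta>" using \<theta> by blast
      qed
      finally show ?thesis by simp
    qed
  qed
  have mse: "MSE RDP r (C * \<sigma>\<^sup>2 * ln (real n)) 1 n \<sigma> \<theta>s
      \<le> Cr * \<sigma>\<^sup>2 * (?k n \<theta>s * ln (real n) * ?l n \<theta>s / real n)"
    if \<theta>s: "\<theta>s \<in> arrays 1 n" and \<sigma>: "0 < \<sigma>" and n: "2 \<le> n" for \<sigma> n \<theta>s
  proof -
    \<comment> \<open>With the truth as competitor, only the penalty term of \<open>sharp\<close>
      remains.\<close>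
    have "sq_dist (grid 1 n) \<theta>s \<theta>s = 0" by (simp add: sq_dist_eq_ip ip_def)
    then have "risk RDP r (C * \<sigma>\<^sup>2 * ln (real n)) 1 n \<sigma> \<theta>s
        \<le> C * \<sigma>\<^sup>2 * ln (real n) * K * ?k n \<theta>s * ?l n \<theta>s"
      using sharp[OF \<sigma> n order_refl \<theta>s, of \<theta>s] by simp
    also have "\<dots> = C * K * (\<sigma>\<^sup>2 * (?k n \<theta>s * ln (real n) * ?l n \<theta>s))"
      by (simp only: mult.assoc mult.commute mult.left_commute)
    also have "\<dots> \<le> Cr * (\<sigma>\<^sup>2 * (?k n \<theta>s * ln (real n) * ?l n \<theta>s))"
      using Cr l[OF _ \<theta>s] n by (intro mult_right_mono mult_nonneg_nonneg) auto
    finally have "risk RDP r (C * \<sigma>\<^sup>2 * ln (real n)) 1 n \<sigma> \<theta>s / real n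
        \<le> Cr * (\<sigma>\<^sup>2 * (?k n \<theta>s * ln (real n) * ?l n \<theta>s)) / real n"
      by (rule divide_right_mono) simp
    then show ?thesis by (simp add: MSE_def mult.assoc)
  qed
  show ?thesis
    using Cr(4) bound mse by (intro exI[of _ Cr] conjI allI ballI impI) auto
qed

end
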